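(* Let $n$ be a positive integer, let $H$ be a Hilbert space, and let $\omega,\tau:\mathcal{E}_n\to B(H)$ be two nondegenerate $*$-representations of the Toeplitz algebra $\mathcal{E}_n$ on $H$. Then $\omega$ and $\tau$ are $B(H)$-quasifree equivalent if and only if they have the same multiplicity.
   Context: The Toeplitz algebra $\mathcal{E}_n$ ($1\le n<\infty$) is the universal unital $C^*$-algebra generated by isometries $v_1,\dots,v_n$ with $v_i^*v_j=\delta_{ij}I$. $E_n$ denotes the complex linear span of $v_1,\dots,v_n$ in $\mathcal{E}_n$. The multiplicity of a nondegenerate $*$-representation $\pi:\mathcal{E}_n\to B(H)$ is the dimension of $(\pi(E_n)H)^\perp$. Let $D\subset B(H)$ be a unital $C^*$-subalgebra (containing $I_H$). $D^n$ is the free right Hilbert $D$-module of rank $n$ with inner product $\langle (a_i),(b_i)\rangle=\sum_i a_i^*b_i$ and standard basis $e_1,\dots,e_n$; $L(D^n)$ is the algebra of adjointable $D$-module homomorphisms $D^n\to D^n$. For a nondegenerate $*$-representation $\omega$ of $\mathcal{E}_n$ on $H$ put $\sigma_\omega(x)=\sum_{i=1}^n\omega(v_i)\langle e_i,x\rangle\in B(H)$ for $x\in D^n$. Two nondegenerate representations $\omega,\tau$ of $\mathcal{E}_n$ on $H$ are $D$-free equivalent if there is a unitary $U\in L(D^n)$ with $\sigma_\omega=\sigma_\tau\circ U$. A unitary $W\in B(H)$ is $D$-fixing if $\mathrm{Ad}_W:T\mapsto WTW^*$ restricts to an automorphism of $D$ (so every unitary is $B(H)$-fixing). $\mathrm{Ad}_W\circ\tau$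 is the representation of $\mathcal{E}_n$ determined by $v_i\mapsto W\tau(v_i)W^*$. Two nondegenerate representations $\omega,\tau$ on $H$ are $D$-quasifree equivalent if there is a $D$-fixing unitary $W\in B(H)$ such that $\omega$ and $\mathrm{Ad}_W\circ\tau$ are $D$-free equivalent. Here $D=B(H)$. *)

theory Defs
  imports "HOL-Analysis.Analysis" "HOL-Algebra.Module"
begin

text \<open>
  The real Hilbert space structure of the library (norm, metric, completeness) is kept, and a
  complex scalar multiplication and inner product compatible with it are added.  The complex
  inner product is linear in its second argument.
\<close>

class chilbert_space = real_inner + complete_space +
  fixes scaleC :: "complex \<Rightarrow> 'a \<Rightarrow> 'a" (infixr \<open>*\<^sub>C\<close> 75)
    and cinner :: "'a \<Rightarrow> 'a \<Rightarrow> complex"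
  assumes scaleC_add_right: "c *\<^sub>C (x + y) = c *\<^sub>C x + c *\<^sub>C y"
    and scaleC_add_left: "(c + d) *\<^sub>C x = c *\<^sub>C x + d *\<^sub>C x"
    and scaleC_scaleC: "c *\<^sub>C (d *\<^sub>C x) = (c * d) *\<^sub>C x"
    and scaleR_scaleC: "r *\<^sub>R x = complex_of_real r *\<^sub>C x"
    and cinner_commute: "cinner x y = cnj (cinner y x)"
    and cinner_add_right: "cinner x (y + z) = cinner x y + cinner x z"
    and cinner_scaleC_right: "cinner x (c *\<^sub>C y) = c * cinner x y"
    and inner_cinner: "inner x y = Re (cinner x y)"

lemma vector_space_scaleC: "vector_space (scaleC :: complex \<Rightarrow> 'a::chilbert_space \<Rightarrow> 'a)"
proof
  show "1 *\<^sub>C x = x" for x :: 'a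
    using scaleR_scaleC[of 1 x] by simp
qed (simp_all add: scaleC_add_right scaleC_add_left scaleC_scaleC)

abbreviation cspan :: "'a::chilbert_space set \<Rightarrow> 'a set" where
  "cspan \<equiv> Modules.module.span scaleC"

definition orth_compl :: "'a::chilbert_space set \<Rightarrow> 'a set" where
  "orth_compl S = {x. \<forall>y\<in>S. cinner y x = 0}"

definition is_onb :: "'a::chilbert_space set \<Rightarrow> 'a set \<Rightarrow> bool" where
  "is_onb B M \<longleftrightarrow>
     (\<forall>x\<in>B. \<forall>y\<in>B. cinner x y = (if x = y then 1 else 0)) \<and> closure (cspan B) = M"

text \<open>
  Hilbert space dimension of a closed subspace, as a cardinal in the sense of
  HOL's cardinal theory; dimensions are compared by \<^const>\<open>ordIso\<close>.
\<close>

definition hilbert_dim :: "'a::chilbert_space set \<Rightarrow> 'a rel" where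
  "hilbert_dim M = card_of (SOME B. is_onb B M)"

record 'a cstar = "(complex, 'a) module" +
  star :: "'a \<Rightarrow> 'a"
  cnorm :: "'a \<Rightarrow> real"

definition complex_ring :: "complex ring" where
  "complex_ring = \<lparr>carrier = UNIV, monoid.mult = (*), one = 1, zero = 0, add = (+)\<rparr>"

text \<open>\<^locale>\<open>Metric_space\<close> requires symmetry and nonnegativity off the carrier as well.\<close>

definition cstar_dist :: "'a cstar \<Rightarrow> 'a \<Rightarrow> 'a \<Rightarrow> real" where
  "cstar_dist A x y =
     (if x \<in> carrier A \<and> y \<in> carrier A then cnorm A (x \<ominus>\<^bsub>A\<^esub> y) else 0)"

locale cstar_algebra = ring A + Module.module complex_ring A
  for A :: "'a cstar" (structure) +
  assumes smult_mult_left: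
      "\<lbrakk>x \<in> carrier A; y \<in> carrier A\<rbrakk> \<Longrightarrow> (c \<odot> x) \<otimes> y = c \<odot> (x \<otimes> y)"
    and smult_mult_right:
      "\<lbrakk>x \<in> carrier A; y \<in> carrier A\<rbrakk> \<Longrightarrow> x \<otimes> (c \<odot> y) = c \<odot> (x \<otimes> y)"
    and star_closed: "x \<in> carrier A \<Longrightarrow> star A x \<in> carrier A"
    and star_star: "x \<in> carrier A \<Longrightarrow> star A (star A x) = x"
    and star_add:
      "\<lbrakk>x \<in> carrier A; y \<in> carrier A\<rbrakk> \<Longrightarrow> star A (x \<oplus> y) = star A x \<oplus> star A y"
    and star_smult: "x \<in> carrier A \<Longrightarrow> star A (c \<odot> x) = cnj c \<odot> star A x"
    and star_mult:
      "\<lbrakk>x \<in> carrier A; y \<in> carrier A\<rbrakk> \<Longrightarrow> star A (x \<otimes> y) = star A y \<otimes> star A x"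
    and cnorm_nonneg: "x \<in> carrier A \<Longrightarrow> 0 \<le> cnorm A x"
    and cnorm_eq_zero: "x \<in> carrier A \<Longrightarrow> cnorm A x = 0 \<longleftrightarrow> x = \<zero>"
    and cnorm_triangle:
      "\<lbrakk>x \<in> carrier A; y \<in> carrier A\<rbrakk> \<Longrightarrow> cnorm A (x \<oplus> y) \<le> cnorm A x + cnorm A y"
    and cnorm_smult: "x \<in> carrier A \<Longrightarrow> cnorm A (c \<odot> x) = cmod c * cnorm A x"
    and cnorm_mult:
      "\<lbrakk>x \<in> carrier A; y \<in> carrier A\<rbrakk> \<Longrightarrow> cnorm A (x \<otimes> y) \<le> cnorm A x * cnorm A y"
    and cstar_identity: "x \<in> carrier A \<Longrightarrow> cnorm A (star A x \<otimes> x) = (cnorm A x)\<^sup>2"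
    and complete: "Metric_space.mcomplete (carrier A) (cstar_dist A)"

definition star_hom :: "'a cstar \<Rightarrow> 'b cstar \<Rightarrow> ('a \<Rightarrow> 'b) \<Rightarrow> bool" where
  "star_hom A B \<phi> \<longleftrightarrow>
     \<phi> \<in> carrier A \<rightarrow> carrier B \<and>
     (\<forall>x\<in>carrier A. \<forall>y\<in>carrier A. \<phi> (x \<oplus>\<^bsub>A\<^esub> y) = \<phi> x \<oplus>\<^bsub>B\<^esub> \<phi> y) \<and>
     (\<forall>c. \<forall>x\<in>carrier A. \<phi> (c \<odot>\<^bsub>A\<^esub> x) = c \<odot>\<^bsub>B\<^esub> \<phi> x) \<and>
     (\<forall>x\<in>carrier A. \<forall>y\<in>carrier A. \<phi> (x \<otimes>\<^bsub>A\<^esub> y) = \<phi> x \<otimes>\<^bsub>B\<^esub> \<phi> y) \<and>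
     (\<forall>x\<in>carrier A. \<phi> (star A x) = star B (\<phi> x))"

definition star_automorphism :: "'a cstar \<Rightarrow> ('a \<Rightarrow> 'a) \<Rightarrow> bool" where
  "star_automorphism A \<phi> \<longleftrightarrow> star_hom A A \<phi> \<and> bij_betw \<phi> (carrier A) (carrier A)"

definition cstar_subalgebra :: "'a cstar \<Rightarrow> 'a set \<Rightarrow> bool" where
  "cstar_subalgebra A S \<longleftrightarrow>
     S \<subseteq> carrier A \<and> \<one>\<^bsub>A\<^esub> \<in> S \<and>
     (\<forall>x\<in>S. \<forall>y\<in>S. x \<oplus>\<^bsub>A\<^esub> y \<in> S \<and> x \<otimes>\<^bsub>A\<^esub> y \<in> S) \<and>
     (\<forall>c. \<forall>x\<in>S. c \<odot>\<^bsub>A\<^esub> x \<in> S) \<and>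
     (\<forall>x\<in>S. star A x \<in> S) \<and>
     closedin (Metric_space.mtopology (carrier A) (cstar_dist A)) S"

definition cstar_generated_by :: "'a cstar \<Rightarrow> 'a set \<Rightarrow> bool" where
  "cstar_generated_by A G \<longleftrightarrow> (\<forall>S. cstar_subalgebra A S \<and> G \<subseteq> S \<longrightarrow> S = carrier A)"

definition toeplitz_family :: "nat \<Rightarrow> 'a cstar \<Rightarrow> (nat \<Rightarrow> 'a) \<Rightarrow> bool" where
  "toeplitz_family n A v \<longleftrightarrow>
     (\<forall>i\<in>{1..n}. v i \<in> carrier A) \<and>
     (\<forall>i\<in>{1..n}. \<forall>j\<in>{1..n}. star A (v i) \<otimes>\<^bsub>A\<^esub> v j = (if i = j then \<one>\<^bsub>A\<^esub> else \<zero>\<^bsub>A\<^esub>))"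

text \<open>
  \<open>E\<close> with generators \<open>v 1, \<dots>, v n\<close> is the universal unital C*-algebra for these relations.
  HOL cannot quantify over all C*-algebras at once, so the test algebras \<open>B\<close> have their
  carriers inside a type with continuum many elements.  This loses nothing: only the unital
  C*-subalgebra generated by the \<open>w i\<close> matters, it is separable and so has at most continuum many
  elements, hence it has an isomorphic copy whose carrier is a set of elements of type
  \<^typ>\<open>nat set\<close>.  The homomorphism is unique on the carrier since the \<open>v i\<close> generate \<open>E\<close>
  and *-homomorphisms are contractive.
\<close>

definition toeplitz_algebra :: "nat \<Rightarrow> 'e cstar \<Rightarrow> (nat \<Rightarrow> 'e) \<Rightarrow> bool" where
  "toeplitz_algebra n E v \<longleftrightarrow>
     cstar_algebra E \<and> toeplitz_family n E v \<and> cstar_generated_by E (v ` {1..n}) \<and>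
     (\<forall>(B :: nat set cstar) w. cstar_algebra B \<and> toeplitz_family n B w \<longrightarrow>
        (\<exists>\<phi>. star_hom E B \<phi> \<and> \<phi> \<one>\<^bsub>E\<^esub> = \<one>\<^bsub>B\<^esub> \<and> (\<forall>i\<in>{1..n}. \<phi> (v i) = w i)))"

definition gen_span :: "nat \<Rightarrow> 'e cstar \<Rightarrow> (nat \<Rightarrow> 'e) \<Rightarrow> 'e set" where
  "gen_span n E v = range (\<lambda>c :: nat \<Rightarrow> complex. finsum E (\<lambda>i. c i \<odot>\<^bsub>E\<^esub> v i) {1..n})"

definition bounded_clinear :: "('h::chilbert_space \<Rightarrow> 'h) \<Rightarrow> bool" where
  "bounded_clinear T \<longleftrightarrow> bounded_linear T \<and> (\<forall>c x. T (c *\<^sub>C x) = c *\<^sub>C T x)"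

definition adj :: "('h::chilbert_space \<Rightarrow> 'h) \<Rightarrow> ('h \<Rightarrow> 'h)" where
  "adj T = (THE S. bounded_clinear S \<and> (\<forall>x y. cinner (S x) y = cinner x (T y)))"

definition BH :: "('h::chilbert_space \<Rightarrow> 'h) cstar" where
  "BH = \<lparr>carrier = Collect bounded_clinear, monoid.mult = (\<circ>), one = id,
         zero = (\<lambda>h. 0), add = (\<lambda>S T h. S h + T h), smult = (\<lambda>c T h. c *\<^sub>C T h),
         star = adj, cnorm = onorm\<rparr>"

definition nondeg_rep :: "'e cstar \<Rightarrow> ('e \<Rightarrow> 'h::chilbert_space \<Rightarrow> 'h) \<Rightarrow> bool" where
  "nondeg_rep E \<omega> \<longleftrightarrow>
     star_hom E BH \<omega> \<and> closure (cspan {\<omega> a h | a h. a \<in> carrier E}) = UNIV"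

definition rep_multiplicity ::
  "nat \<Rightarrow> 'e cstar \<Rightarrow> (nat \<Rightarrow> 'e) \<Rightarrow> ('e \<Rightarrow> 'h::chilbert_space \<Rightarrow> 'h) \<Rightarrow> 'h rel" where
  "rep_multiplicity n E v \<omega> = hilbert_dim (orth_compl {\<omega> a h | a h. a \<in> gen_span n E v})"

definition unitary_op :: "('h::chilbert_space \<Rightarrow> 'h) \<Rightarrow> bool" where
  "unitary_op W \<longleftrightarrow> bounded_clinear W \<and> adj W \<circ> W = id \<and> W \<circ> adj W = id"

definition Ad :: "('h::chilbert_space \<Rightarrow> 'h) \<Rightarrow> ('h \<Rightarrow> 'h) \<Rightarrow> ('h \<Rightarrow> 'h)" where
  "Ad W T = W \<circ> T \<circ> adj W"

text \<open>
  Here \<open>D\<close> is the underlying set of a unital C*-subalgebra of \<^const>\<open>BH\<close>, and elements of the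
  module are functions on \<open>{1..n}\<close>, extended by \<^const>\<open>undefined\<close>.
\<close>

definition Dn :: "nat \<Rightarrow> ('h \<Rightarrow> 'h) set \<Rightarrow> (nat \<Rightarrow> 'h \<Rightarrow> 'h) set" where
  "Dn n D = {1..n} \<rightarrow>\<^sub>E D"

definition Dn_add ::
  "nat \<Rightarrow> (nat \<Rightarrow> 'h \<Rightarrow> 'h::chilbert_space) \<Rightarrow> (nat \<Rightarrow> 'h \<Rightarrow> 'h) \<Rightarrow> (nat \<Rightarrow> 'h \<Rightarrow> 'h)" where
  "Dn_add n x y = (\<lambda>i\<in>{1..n}. \<lambda>h. x i h + y i h)"

definition Dn_act ::
  "nat \<Rightarrow> (nat \<Rightarrow> 'h \<Rightarrow> 'h) \<Rightarrow> ('h \<Rightarrow> 'h) \<Rightarrow> (nat \<Rightarrow> 'h \<Rightarrow> 'h)" where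
  "Dn_act n x d = (\<lambda>i\<in>{1..n}. x i \<circ> d)"

definition Dn_inner ::
  "nat \<Rightarrow> (nat \<Rightarrow> 'h \<Rightarrow> 'h::chilbert_space) \<Rightarrow> (nat \<Rightarrow> 'h \<Rightarrow> 'h) \<Rightarrow> ('h \<Rightarrow> 'h)" where
  "Dn_inner n x y = (\<lambda>h. \<Sum>i=1..n. (adj (x i) \<circ> y i) h)"

definition Dn_basis :: "nat \<Rightarrow> nat \<Rightarrow> (nat \<Rightarrow> 'h \<Rightarrow> 'h::chilbert_space)" where
  "Dn_basis n i = (\<lambda>j\<in>{1..n}. if j = i then id else (\<lambda>h. 0))"

definition Dn_adjoint_pair :: "nat \<Rightarrow> ('h::chilbert_space \<Rightarrow> 'h) set \<Rightarrow>
    ((nat \<Rightarrow> 'h \<Rightarrow> 'h) \<Rightarrow> (nat \<Rightarrow> 'h \<Rightarrow> 'h)) \<Rightarrow> ((nat \<Rightarrow> 'h \<Rightarrow> 'h) \<Rightarrow> (nat \<Rightarrow> 'h \<Rightarrow> 'h)) \<Rightarrow> bool"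
  where
  "Dn_adjoint_pair n D U V \<longleftrightarrow>
     (\<forall>x\<in>Dn n D. \<forall>y\<in>Dn n D. Dn_inner n (U x) y = Dn_inner n x (V y))"

definition L_Dn :: "nat \<Rightarrow> ('h::chilbert_space \<Rightarrow> 'h) set \<Rightarrow>
    ((nat \<Rightarrow> 'h \<Rightarrow> 'h) \<Rightarrow> (nat \<Rightarrow> 'h \<Rightarrow> 'h)) set" where
  "L_Dn n D =
     {U \<in> Dn n D \<rightarrow> Dn n D.
        (\<forall>x\<in>Dn n D. \<forall>y\<in>Dn n D. U (Dn_add n x y) = Dn_add n (U x) (U y)) \<and>
        (\<forall>x\<in>Dn n D. \<forall>d\<in>D. U (Dn_act n x d) = Dn_act n (U x) d) \<and>
        (\<exists>V\<in>Dn n D \<rightarrow> Dn n D. Dn_adjoint_pair n D U V)}"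

definition unitary_Dn :: "nat \<Rightarrow> ('h::chilbert_space \<Rightarrow> 'h) set \<Rightarrow>
    ((nat \<Rightarrow> 'h \<Rightarrow> 'h) \<Rightarrow> (nat \<Rightarrow> 'h \<Rightarrow> 'h)) \<Rightarrow> bool" where
  "unitary_Dn n D U \<longleftrightarrow>
     U \<in> L_Dn n D \<and>
     (\<exists>V\<in>L_Dn n D. Dn_adjoint_pair n D U V \<and> (\<forall>x\<in>Dn n D. V (U x) = x \<and> U (V x) = x))"

definition sigma_rep ::
  "nat \<Rightarrow> (nat \<Rightarrow> 'e) \<Rightarrow> ('e \<Rightarrow> 'h::chilbert_space \<Rightarrow> 'h) \<Rightarrow> (nat \<Rightarrow> 'h \<Rightarrow> 'h) \<Rightarrow> ('h \<Rightarrow> 'h)" where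
  "sigma_rep n v \<omega> x = (\<lambda>h. \<Sum>i=1..n. (\<omega> (v i) \<circ> Dn_inner n (Dn_basis n i) x) h)"

definition free_equiv :: "nat \<Rightarrow> (nat \<Rightarrow> 'e) \<Rightarrow> ('h::chilbert_space \<Rightarrow> 'h) set \<Rightarrow>
    ('e \<Rightarrow> 'h \<Rightarrow> 'h) \<Rightarrow> ('e \<Rightarrow> 'h \<Rightarrow> 'h) \<Rightarrow> bool" where
  "free_equiv n v D \<omega> \<tau> \<longleftrightarrow>
     (\<exists>U. unitary_Dn n D U \<and> (\<forall>x\<in>Dn n D. sigma_rep n v \<omega> x = sigma_rep n v \<tau> (U x)))"

definition fixing_unitary :: "('h::chilbert_space \<Rightarrow> 'h) set \<Rightarrow> ('h \<Rightarrow> 'h) \<Rightarrow> bool" where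
  "fixing_unitary D W \<longleftrightarrow> unitary_op W \<and> star_automorphism (BH\<lparr>carrier := D\<rparr>) (Ad W)"

definition quasifree_equiv :: "nat \<Rightarrow> (nat \<Rightarrow> 'e) \<Rightarrow> ('h::chilbert_space \<Rightarrow> 'h) set \<Rightarrow>
    ('e \<Rightarrow> 'h \<Rightarrow> 'h) \<Rightarrow> ('e \<Rightarrow> 'h \<Rightarrow> 'h) \<Rightarrow> bool" where
  "quasifree_equiv n v D \<omega> \<tau> \<longleftrightarrow>
     (\<exists>W. fixing_unitary D W \<and> free_equiv n v D \<omega> (Ad W \<circ> \<tau>))"

end

theory Submission
  imports Defs
begin

text \<open>
  Write \<open>S\<^sub>i = \<omega>(v\<^sub>i)\<close> and \<open>T\<^sub>i = \<tau>(v\<^sub>i)\<close>; the multiplicities are the dimensions of the defect spaces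
  \<open>K\<^sub>S = (\<Sum> S\<^sub>i H)\<^sup>\<bottom>\<close> and \<open>K\<^sub>T\<close>.  A \<open>B(H)\<close>-free equivalence does not change \<open>\<Sum> S\<^sub>i H\<close>, and conjugation by
  \<open>W\<close> carries \<open>K\<^sub>T\<close> onto \<open>W K\<^sub>T\<close>, so quasifree equivalent representations have equal multiplicity.
  Conversely, let \<open>g\<close> be a unitary from \<open>K\<^sub>T\<close> onto \<open>K\<^sub>S\<close> and let \<open>Q = 1 - \<Sum> T\<^sub>i T\<^sub>i\<^sup>*\<close> be the projection onto
  \<open>K\<^sub>T\<close>.  Then \<open>W = \<Sum> S\<^sub>i T\<^sub>i\<^sup>* + g Q\<close> is a unitary on \<open>H\<close> with \<open>W T\<^sub>i = S\<^sub>i\<close>.  Thus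
  \<open>S\<^sub>i = (W T\<^sub>i W\<^sup>*) W\<close>, and the diagonal matrix with entries \<open>W\<close> is the required unitary of \<open>L(D\<^sup>n)\<close>.
\<close>

section \<open>Hilbert space preliminaries\<close>

interpretation cvs: vector_space "scaleC :: complex \<Rightarrow> 'a::chilbert_space \<Rightarrow> 'a"
  by (rule vector_space_scaleC)

interpretation cvp: vector_space_pair
  "scaleC :: complex \<Rightarrow> 'a::chilbert_space \<Rightarrow> 'a" "scaleC :: complex \<Rightarrow> 'b::chilbert_space \<Rightarrow> 'b"
  ..

section \<open>Sesquilinearity, norm and continuity of the complex inner product\<close>

lemma cinner_add_left: "cinner (x + y) z = cinner x z + cinner y z"
  by (metis cinner_add_right cinner_commute complex_cnj_add)

lemma cinner_scaleC_left: "cinner (c *\<^sub>C x) y = cnj c * cinner x y"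
  by (metis cinner_commute cinner_scaleC_right complex_cnj_mult)

lemma Re_cinner: "Re (cinner x y) = inner x y"
  by (simp add: inner_cinner)

text \<open>Linearity in the second argument gives <x, iy> = i<x, y>, whose real part is -Im <x, y>.
  Real statements applied to both y and iy can therefore be upgraded to complex ones.\<close>

lemma Im_cinner: "Im (cinner x y) = - inner x (\<i> *\<^sub>C y)"
  by (simp add: inner_cinner cinner_scaleC_right)

lemma cinner_self: "cinner x x = complex_of_real ((norm x)\<^sup>2)"
proof -
  have "Im (cinner x x) = 0"
    using arg_cong[OF cinner_commute[of x x], of Im] by simp
  then show ?thesis
    by (simp add: complex_eq_iff Re_cinner power2_norm_eq_inner)
qed

lemma cinner_self_eq_zero [simp]: "cinner x x = 0 \<longleftrightarrow> x = 0"
  by (simp add: cinner_self)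

text \<open>The class ties the norm to the real structure; squaring and passing through
  \<open>cinner x x\<close> recovers complex homogeneity.\<close>

lemma norm_scaleC: "norm (c *\<^sub>C x) = cmod c * norm x"
proof -
  have "complex_of_real ((norm (c *\<^sub>C x))\<^sup>2) = complex_of_real ((cmod c * norm x)\<^sup>2)"
    unfolding cinner_self[symmetric] cinner_scaleC_left cinner_scaleC_right
    by (simp add: cinner_self power_mult_distrib complex_norm_square del: of_real_power)
  then show ?thesis
    by (metis norm_ge_zero mult_nonneg_nonneg of_real_eq_iff power2_eq_iff_nonneg)
qed

lemma bounded_bilinear_cinner: "bounded_bilinear (cinner :: 'a::chilbert_space \<Rightarrow> 'a \<Rightarrow> complex)"
proof
  show "cinner (r *\<^sub>R x) y = r *\<^sub>R cinner x y" "cinner x (r *\<^sub>R y) = r *\<^sub>R cinner x y"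
    for r and x y :: 'a
    by (simp_all add: scaleR_scaleC cinner_scaleC_left cinner_scaleC_right scaleR_conv_of_real)
  have "norm (cinner x y) \<le> norm x * norm y * 2" for x y :: 'a
  proof -
    \<comment> \<open>Real and imaginary parts are estimated separately by the real Cauchy-Schwarz
      inequality, whence the factor 2.\<close>
    have "norm (cinner x y) \<le> \<bar>inner x y\<bar> + \<bar>inner x (\<i> *\<^sub>C y)\<bar>"
      using cmod_le[of "cinner x y"] by (simp add: Re_cinner Im_cinner)
    also have "\<dots> \<le> norm x * norm y + norm x * norm (\<i> *\<^sub>C y)"
      by (intro add_mono Cauchy_Schwarz_ineq2)
    finally show ?thesis by (simp add: norm_scaleC)
  qed
  then show "\<exists>K. \<forall>x y :: 'a. norm (cinner x y) \<le> norm x * norm y * K"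
    by blast
qed (simp_all add: cinner_add_left cinner_add_right)

interpretation cinner: bounded_bilinear "cinner :: 'a::chilbert_space \<Rightarrow> 'a \<Rightarrow> complex"
  by (rule bounded_bilinear_cinner)

declare cinner.zero_left [simp] cinner.zero_right [simp]

lemma cinner_cancel_left: "(\<And>z. cinner z x = cinner z y) \<Longrightarrow> x = y"
  by (metis cinner.diff_right cinner_self_eq_zero eq_iff_diff_eq_0)

lemma cinner_eq_0_commute: "cinner x y = 0 \<longleftrightarrow> cinner y x = 0"
  by (metis cinner_commute complex_cnj_zero)

lemma bounded_linear_scaleC: "bounded_linear (scaleC c :: 'a \<Rightarrow> 'a::chilbert_space)"
proof
  show "\<exists>K. \<forall>x :: 'a. norm (c *\<^sub>C x) \<le> norm x * K"
    by (rule exI[of _ "cmod c"]) (simp add: norm_scaleC)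
qed (simp_all add: scaleC_add_right scaleR_scaleC scaleC_scaleC mult.commute)

section \<open>Closed complex subspaces, orthogonal projection and Riesz representation\<close>

lemma subspace_of_csubspace: "cvs.subspace S \<Longrightarrow> subspace S"
  by (simp add: cvs.subspace_def subspace_def scaleR_scaleC)

lemma csubspace_closure: "cvs.subspace S \<Longrightarrow> cvs.subspace (closure S)"
proof -
  assume S: "cvs.subspace S"
  have "scaleC c ` closure S \<subseteq> closure S" for c
    using closure_bounded_linear_image_subset[OF bounded_linear_scaleC, of c S] S
    by (meson closure_mono cvs.subspace_def image_subsetI order_trans)
  moreover have "x + y \<in> closure S" if "x \<in> closure S" "y \<in> closure S" for x y
  proof -
    \<comment> \<open>Addition is continuous on the product, and the closure of a product is the
      product of the closures.\<close>
    have "(\<lambda>(a, b). a + b) ` (S \<times> S) \<subseteq> S"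
      using S by (auto simp: cvs.subspace_def)
    then have "(\<lambda>(a, b). a + b) ` closure (S \<times> S) \<subseteq> closure S"
      by (intro image_closure_subset)
        (auto intro!: continuous_intros simp: case_prod_beta intro: closure_subset[THEN subsetD])
    then show ?thesis
      using that by (auto simp: closure_Times)
  qed
  moreover have "0 \<in> closure S"
    using S closure_subset by (auto simp: cvs.subspace_def)
  ultimately show ?thesis
    by (auto simp: cvs.subspace_def)
qed

lemma closed_csubspace_orth_compl:
  "cvs.subspace (orth_compl S)" "closed (orth_compl S)"
proof -
  show "cvs.subspace (orth_compl S)"
    by (auto simp: cvs.subspace_def orth_compl_def cinner_add_right cinner_scaleC_right)
  have "orth_compl S = (\<Inter>y\<in>S. {x. cinner y x = 0})"
    by (auto simp: orth_compl_def)
  moreover have "closed {x. cinner y x = 0}" for y :: 'a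
    by (intro closed_Collect_eq continuous_intros cinner.continuous_on)
  ultimately show "closed (orth_compl S)"
    by auto
qed

lemma closure_cspan_subset:
  assumes "closed M" "cvs.subspace M" "B \<subseteq> M"
  shows "closure (cspan B) \<subseteq> M"
  by (meson assms closure_minimal cvs.span_minimal)

text \<open>By symmetry of orthogonality, a vector x orthogonal to B puts B inside the closed
  subspace \<open>orth_compl {x}\<close>, which then contains the closed span of B.\<close>

lemma orth_compl_closure_cspan: "orth_compl (closure (cspan B)) = orth_compl B"
proof
  show "orth_compl (closure (cspan B)) \<subseteq> orth_compl B"
    using closure_subset[of "cspan B"] cvs.span_superset[of B] by (auto simp: orth_compl_def)
  show "orth_compl B \<subseteq> orth_compl (closure (cspan B))"
  proof
    fix x assume x: "x \<in> orth_compl B"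
    have "B \<subseteq> orth_compl {x}"
      using x by (auto simp: orth_compl_def cinner_eq_0_commute)
    then have "closure (cspan B) \<subseteq> orth_compl {x}"
      by (intro closure_cspan_subset closed_csubspace_orth_compl)
    then show "x \<in> orth_compl (closure (cspan B))"
      by (auto simp: orth_compl_def cinner_eq_0_commute)
  qed
qed

text \<open>A distance-minimizing sequence in S is Cauchy by the parallelogram law, and its limit p
  is the foot of the perpendicular by a variational argument.\<close>

lemma orthogonal_projection_exists:
  fixes S :: "'a::{real_inner, complete_space} set"
  assumes "closed S" "subspace S"
  shows "\<exists>p\<in>S. \<forall>y\<in>S. inner (x - p) y = 0"
proof -
  define d where "d = (INF y\<in>S. (norm (x - y))\<^sup>2)"
  have ne: "S \<noteq> {}"
    using assms(2) subspace_0 by blast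
  have bdd: "bdd_below ((\<lambda>y. (norm (x - y))\<^sup>2) ` S)"
    by (rule bdd_belowI[of _ 0]) auto
  have d_le: "d \<le> (norm (x - y))\<^sup>2" if "y \<in> S" for y
    unfolding d_def by (rule cINF_lower[OF bdd that])
  have "\<exists>y\<in>S. (norm (x - y))\<^sup>2 < d + inverse (real (Suc k))" for k
    using cINF_less_iff[OF ne bdd, of "d + inverse (real (Suc k))"]
    unfolding d_def by (simp del: of_nat_Suc)
  then obtain f where f: "\<And>k. f k \<in> S" "\<And>k. (norm (x - f k))\<^sup>2 < d + inverse (real (Suc k))"
    by metis
  \<comment> \<open>The midpoint of a and b lies in S, so its squared distance to x is at least d;
    the parallelogram law then bounds the distance from a to b.\<close>
  have close: "(norm (a - b))\<^sup>2 \<le> 2 * e1 + 2 * e2"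
    if "a \<in> S" "b \<in> S" "(norm (x - a))\<^sup>2 < d + e1" "(norm (x - b))\<^sup>2 < d + e2" for a b e1 e2
  proof -
    have "(1/2) *\<^sub>R (a + b) \<in> S"
      using that assms(2) by (simp add: subspace_add subspace_scale)
    from d_le[OF this] have "4 * d \<le> (norm (2 *\<^sub>R (x - (1/2) *\<^sub>R (a + b))))\<^sup>2"
      by (simp add: power_mult_distrib)
    also have "2 *\<^sub>R (x - (1/2) *\<^sub>R (a + b)) = (x - a) + (x - b)"
      by (simp add: algebra_simps scaleR_2)
    finally have "4 * d \<le> (norm ((x - a) + (x - b)))\<^sup>2" .
    moreover have "(norm (a - b))\<^sup>2 = 2 * (norm (x - a))\<^sup>2 + 2 * (norm (x - b))\<^sup>2
        - (norm ((x - a) + (x - b)))\<^sup>2"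
      by (simp add: power2_norm_eq_inner algebra_simps inner_commute)
    ultimately show ?thesis
      using that(3,4) by linarith
  qed
  have "Cauchy f"
  proof (rule metric_CauchyI)
    fix e :: real assume "0 < e"
    define u where "u k = inverse (real (Suc k))" for k
    obtain N where N: "u N < e\<^sup>2 / 4"
      using reals_Archimedean[of "e\<^sup>2 / 4"] \<open>0 < e\<close> by (auto simp: u_def)
    have u: "u k \<le> u N" if "N \<le> k" for k
      using that by (simp add: u_def field_simps)
    have "dist (f i) (f j) < e" if "N \<le> i" "N \<le> j" for i j
    proof -
      have "(norm (f i - f j))\<^sup>2 \<le> 2 * u i + 2 * u j"
        using close[OF f(1) f(1) f(2) f(2)] by (simp only: u_def)
      then have "(norm (f i - f j))\<^sup>2 < e\<^sup>2"
        using N u[OF that(1)] u[OF that(2)] by linarith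
      then show ?thesis
        using \<open>0 < e\<close> by (simp add: dist_norm power2_less_imp_less)
    qed
    then show "\<exists>M. \<forall>m\<ge>M. \<forall>n\<ge>M. dist (f m) (f n) < e"
      by blast
  qed
  then obtain p where p: "f \<longlonglongrightarrow> p"
    using Cauchy_convergent_iff convergent_def by blast
  have pS: "p \<in> S"
    using assms(1) f(1) p closed_sequentially by blast
  have "(norm (x - p))\<^sup>2 \<le> d"
  proof (rule LIMSEQ_le)
    show "(\<lambda>k. (norm (x - f k))\<^sup>2) \<longlonglongrightarrow> (norm (x - p))\<^sup>2"
      by (intro tendsto_intros p)
    show "(\<lambda>k. d + inverse (real (Suc k))) \<longlonglongrightarrow> d"
      using tendsto_add[OF tendsto_const LIMSEQ_inverse_real_of_nat, of d] by simp
    show "\<exists>N. \<forall>k\<ge>N. (norm (x - f k))\<^sup>2 \<le> d + inverse (real (Suc k))"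
      using f(2) less_imp_le by blast
  qed
  then have min: "(norm (x - p))\<^sup>2 \<le> (norm (x - y))\<^sup>2" if "y \<in> S" for y
    using d_le[OF that] by linarith
  have "inner (x - p) y = 0" if y: "y \<in> S" for y
  proof (cases "y = 0")
    case False
    \<comment> \<open>This t minimizes the quadratic polynomial t -> |x - p - ty|^2, so a nonzero
      inner product would contradict minimality of p.\<close>
    define t where "t = inner (x - p) y / inner y y"
    have "p + t *\<^sub>R y \<in> S"
      using pS y assms(2) by (simp add: subspace_add subspace_scale)
    from min[OF this] have "0 \<le> - 2 * t * inner (x - p) y + t * t * inner y y"
      by (simp add: power2_norm_eq_inner algebra_simps inner_commute)
    also have "\<dots> = - ((inner (x - p) y)\<^sup>2 / inner y y)"
      using False by (simp add: t_def power2_eq_square field_simps)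
    finally show ?thesis
      using False inner_gt_zero_iff[of y] by (metis divide_pos_pos leD neg_0_le_iff_le zero_less_power2)
  qed simp
  then show ?thesis
    using pS by blast
qed

text \<open>If f is nonzero, take z orthogonal to its closed kernel with f z nonzero. Subtracting (f
  y / f z) z from y lands in the kernel, so f y is a multiple of <z, y>.\<close>

lemma riesz_representation:
  fixes f :: "'a::{real_inner, complete_space} \<Rightarrow> real"
  assumes "bounded_linear f"
  shows "\<exists>a. \<forall>x. f x = inner a x"
proof (cases "\<forall>x. f x = 0")
  case True
  then show ?thesis by (intro exI[of _ 0]) simp
next
  case False
  then obtain x where x: "f x \<noteq> 0" by blast
  interpret bounded_linear f by fact
  have "closed {x. f x = 0}"
    by (intro closed_Collect_eq continuous_intros linear_continuous_on assms)
  moreover have "subspace {x. f x = 0}"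
    by (simp add: subspace_def zero add scaleR)
  ultimately obtain p where p: "f p = 0" "\<And>y. f y = 0 \<Longrightarrow> inner (x - p) y = 0"
    using orthogonal_projection_exists[of "{x. f x = 0}" x] by auto
  define z where "z = x - p"
  have fz: "f z \<noteq> 0"
    using x p by (simp add: z_def diff)
  then have z0: "z \<noteq> 0"
    using zero by auto
  have "f y = inner ((f z / inner z z) *\<^sub>R z) y" for y
  proof -
    have "f (y - (f y / f z) *\<^sub>R z) = 0"
      using fz by (simp add: diff scaleR)
    then have "inner z (y - (f y / f z) *\<^sub>R z) = 0"
      using p(2) by (simp add: z_def)
    then have "inner z y = f y / f z * inner z z"
      by (simp add: inner_diff_right)
    then show ?thesis
      using fz z0 by simp
  qed
  then show ?thesis by blast
qed

section \<open>Bounded complex-linear operators and their adjoints\<close>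

lemma bounded_clinear_add: "bounded_clinear T \<Longrightarrow> T (x + y) = T x + T y"
  unfolding bounded_clinear_def by (blast intro: linear_add bounded_linear.linear)

lemma bounded_clinear_diff: "bounded_clinear T \<Longrightarrow> T (x - y) = T x - T y"
  unfolding bounded_clinear_def by (blast intro: linear_diff bounded_linear.linear)

lemma bounded_clinear_zero: "bounded_clinear T \<Longrightarrow> T 0 = 0"
  unfolding bounded_clinear_def by (blast intro: linear_0 bounded_linear.linear)

lemma bounded_clinear_scaleC: "bounded_clinear T \<Longrightarrow> T (c *\<^sub>C x) = c *\<^sub>C T x"
  by (simp add: bounded_clinear_def)

lemma bounded_clinear_sum: "bounded_clinear T \<Longrightarrow> T (\<Sum>i\<in>I. f i) = (\<Sum>i\<in>I. T (f i))"
  unfolding bounded_clinear_def by (blast intro: linear_sum bounded_linear.linear)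

lemma bounded_clinear_id: "bounded_clinear id"
  by (simp add: bounded_clinear_def id_def)

lemma bounded_clinear_const_zero: "bounded_clinear (\<lambda>x. 0)"
  by (simp add: bounded_clinear_def)

lemma bounded_clinear_comp:
  "bounded_clinear S \<Longrightarrow> bounded_clinear T \<Longrightarrow> bounded_clinear (\<lambda>x. S (T x))"
  by (simp add: bounded_clinear_def bounded_linear_compose)

lemma bounded_clinear_o:
  "bounded_clinear S \<Longrightarrow> bounded_clinear T \<Longrightarrow> bounded_clinear (S \<circ> T)"
  by (simp add: o_def bounded_clinear_comp)

text \<open>The real Riesz theorem for y -> Re <x, Ty> gives S x. Complex linearity of T turns the
  real identity into a complex one, since the imaginary part is a real inner product with
  iy.\<close>

lemma adjoint_exists:
  assumes "bounded_clinear (T :: 'h \<Rightarrow> 'h::chilbert_space)"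
  shows "\<exists>S. bounded_clinear S \<and> (\<forall>x y. cinner (S x) y = cinner x (T y))"
proof -
  have T: "bounded_linear T"
    using assms by (simp add: bounded_clinear_def)
  have "\<exists>a. \<forall>y. inner x (T y) = inner a y" for x
    by (intro riesz_representation bounded_linear_inner_right_comp T)
  then obtain S where S: "\<And>x y. inner x (T y) = inner (S x) y"
    by metis
  have adj: "cinner (S x) y = cinner x (T y)" for x y
    by (simp add: complex_eq_iff Re_cinner Im_cinner bounded_clinear_scaleC[OF assms, symmetric] S)
  then have adj': "cinner y (S x) = cinner (T y) x" for x y
    by (metis cinner_commute)
  have "linear S"
    by (intro linearI cinner_cancel_left)
      (simp_all add: adj' cinner_add_right scaleR_scaleC cinner_scaleC_right)
  moreover have "\<exists>K. \<forall>x. norm (S x) \<le> norm x * K"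
  proof -
    obtain K where K: "0 \<le> K" "\<And>x. norm (T x) \<le> norm x * K"
      using bounded_linear.nonneg_bounded[OF T] by blast
    have "norm (S x) \<le> norm x * K" for x
    proof (cases "S x = 0")
      case False
      \<comment> \<open>Bounding |Sx|^2 = Re <x, T(Sx)> and cancelling |Sx| gives S the same bound K
        as T.\<close>
      have "(norm (S x))\<^sup>2 = inner x (T (S x))"
        by (simp add: S power2_norm_eq_inner)
      also have "\<dots> \<le> norm x * norm (T (S x))"
        by (rule norm_cauchy_schwarz)
      also have "\<dots> \<le> norm x * (norm (S x) * K)"
        by (intro mult_left_mono K norm_ge_zero)
      finally have "norm (S x) * norm (S x) \<le> norm (S x) * (norm x * K)"
        by (simp add: power2_eq_square mult.left_commute)
      then show ?thesis
        using False by simp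
    qed (use K in simp)
    then show ?thesis by blast
  qed
  moreover have "S (c *\<^sub>C x) = c *\<^sub>C S x" for c x
    by (intro cinner_cancel_left) (simp add: adj' cinner_scaleC_right)
  ultimately show ?thesis
    using adj unfolding bounded_clinear_def
    by (blast intro: bounded_linear.intro bounded_linear_axioms.intro)
qed

text \<open>\<open>adj\<close> is a definite description, so uniqueness has to accompany existence;
  it holds because the inner products determine each value S x.\<close>

lemma adj_props:
  assumes "bounded_clinear T"
  shows "bounded_clinear (adj T) \<and> (\<forall>x y. cinner (adj T x) y = cinner x (T y))"
proof -
  have "\<exists>!S. bounded_clinear S \<and> (\<forall>x y. cinner (S x) y = cinner x (T y))"
  proof (rule ex_ex1I[OF adjoint_exists[OF assms]])
    fix S S' assume "bounded_clinear S \<and> (\<forall>x y. cinner (S x) y = cinner x (T y))"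
      "bounded_clinear S' \<and> (\<forall>x y. cinner (S' x) y = cinner x (T y))"
    then have "cinner z (S x) = cinner z (S' x)" for x z
      by (metis cinner_commute)
    then show "S = S'"
      by (intro ext cinner_cancel_left)
  qed
  from theI'[OF this] show ?thesis
    unfolding adj_def .
qed

lemma bounded_clinear_adj: "bounded_clinear T \<Longrightarrow> bounded_clinear (adj T)"
  using adj_props by blast

lemma cinner_adj_left: "bounded_clinear T \<Longrightarrow> cinner (adj T x) y = cinner x (T y)"
  using adj_props by blast

lemma cinner_adj_right: "bounded_clinear T \<Longrightarrow> cinner x (adj T y) = cinner (T x) y"
  by (metis cinner_adj_left cinner_commute)

lemma adj_eqI:
  assumes "bounded_clinear T" "\<And>x y. cinner (T x) y = cinner x (S y)"
  shows "adj T = S"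
  by (intro ext cinner_cancel_left) (simp add: assms cinner_adj_right)

lemma adj_adj: "bounded_clinear T \<Longrightarrow> adj (adj T) = T"
  by (simp add: adj_eqI bounded_clinear_adj cinner_adj_left)

lemma adj_id: "adj id = id"
  by (rule adj_eqI) (simp_all add: bounded_clinear_id)

lemma adj_zero: "adj (\<lambda>x. 0) = (\<lambda>x. 0)"
  by (simp add: adj_eqI bounded_clinear_const_zero)

lemma adj_o: "bounded_clinear S \<Longrightarrow> bounded_clinear T \<Longrightarrow> adj (S \<circ> T) = adj T \<circ> adj S"
  by (rule adj_eqI) (simp_all add: bounded_clinear_o cinner_adj_right)

section \<open>Orthonormal bases and dimension\<close>

text \<open>Split off from \<open>is_onb\<close> to speak of orthonormal sets that need not span, as
  in Bessel's inequality and in the Zorn argument.\<close>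

definition orthonormal :: "'a::chilbert_space set \<Rightarrow> bool" where
  "orthonormal B \<longleftrightarrow> (\<forall>x\<in>B. \<forall>y\<in>B. cinner x y = (if x = y then 1 else 0))"

lemma is_onb_iff: "is_onb B M \<longleftrightarrow> orthonormal B \<and> closure (cspan B) = M"
  by (simp add: is_onb_def orthonormal_def)

lemma orthonormal_subset: "orthonormal B \<Longrightarrow> A \<subseteq> B \<Longrightarrow> orthonormal A"
  unfolding orthonormal_def by blast

section \<open>Bessel, Parseval and the invariance of the Hilbert dimension\<close>

lemma cmod_cinner_commute: "cmod (cinner x y) = cmod (cinner y x)"
  by (metis cinner_commute complex_mod_cnj)

lemma orthonormal_cinner_sum:
  assumes "finite F" "orthonormal F" "b \<in> F"
  shows "cinner b (\<Sum>a\<in>F. c a *\<^sub>C a) = c b"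
proof -
  have "cinner b (\<Sum>a\<in>F. c a *\<^sub>C a) = (\<Sum>a\<in>F. c a * cinner b a)"
    by (simp add: cinner.sum_right cinner_scaleC_right)
  also have "\<dots> = (\<Sum>a\<in>F. if b = a then c a else 0)"
    using assms by (intro sum.cong) (auto simp: orthonormal_def)
  finally show ?thesis
    using assms by simp
qed

text \<open>Pythagoras: p x is the orthogonal projection of x onto the span of F, and its squared
  norm is the sum of the squared coefficients.\<close>

lemma bessel_identity:
  assumes "finite F" "orthonormal F"
  defines "p \<equiv> \<lambda>x. \<Sum>a\<in>F. cinner a x *\<^sub>C a"
  shows "(norm x)\<^sup>2 = (norm (x - p x))\<^sup>2 + (\<Sum>a\<in>F. (cmod (cinner a x))\<^sup>2)"
proof -
  have ap: "cinner a (p x) = cinner a x" if "a \<in> F" for a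
    unfolding p_def using orthonormal_cinner_sum[OF assms(1,2) that] .
  have p_left: "cinner (p x) z = (\<Sum>a\<in>F. cnj (cinner a x) * cinner a z)" for z
    by (simp add: p_def cinner.sum_left cinner_scaleC_left)
  have pp: "cinner (p x) (p x) = cinner (p x) x"
    by (simp add: p_left ap)
  then have xp: "cinner x (p x) = cinner (p x) (p x)"
    by (metis cinner_commute)
  have "cinner x x = cinner (x - p x) (x - p x) + cinner (p x) x"
    by (simp add: cinner.diff_left cinner.diff_right pp xp)
  also have "cinner (p x) x = of_real (\<Sum>a\<in>F. (cmod (cinner a x))\<^sup>2)"
    by (simp add: p_left complex_norm_square mult.commute del: of_real_power)
  finally show ?thesis
    by (simp only: cinner_self of_real_add[symmetric] of_real_eq_iff)
qed

lemma bessel_inequality: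
  assumes "finite F" "orthonormal F"
  shows "(\<Sum>a\<in>F. (cmod (cinner a x))\<^sup>2) \<le> (norm x)\<^sup>2"
  using bessel_identity[OF assms, of x] by simp

lemma csubspace_onb: "is_onb B M \<Longrightarrow> cvs.subspace M"
  using csubspace_closure cvs.subspace_span by (auto simp: is_onb_iff)

lemma onb_subset: "is_onb B M \<Longrightarrow> B \<subseteq> M"
  using closure_subset[of "cspan B"] cvs.span_superset[of B] by (auto simp: is_onb_iff)

lemma onb_total:
  assumes "is_onb B M" "x \<in> M" "\<And>b. b \<in> B \<Longrightarrow> cinner b x = 0"
  shows "x = 0"
proof -
  have "x \<in> orth_compl M"
    using assms orth_compl_closure_cspan[of B] by (auto simp: is_onb_iff orth_compl_def)
  then have "cinner x x = 0"
    using assms(2) by (auto simp: orth_compl_def)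
  then show ?thesis by simp
qed

text \<open>The remainder in Bessel's identity lies in M and is orthogonal to the whole basis, so it
  vanishes.\<close>

lemma parseval_finite:
  assumes "is_onb B M" "finite B" "x \<in> M"
  shows "(norm x)\<^sup>2 = (\<Sum>a\<in>B. (cmod (cinner a x))\<^sup>2)"
proof -
  have on: "orthonormal B"
    using assms(1) by (simp add: is_onb_iff)
  have "(\<Sum>a\<in>B. cinner a x *\<^sub>C a) \<in> M"
    using csubspace_onb[OF assms(1)] onb_subset[OF assms(1)]
    by (intro cvs.subspace_sum cvs.subspace_scale) auto
  then have "x - (\<Sum>a\<in>B. cinner a x *\<^sub>C a) = 0"
    using orthonormal_cinner_sum[OF assms(2) on] csubspace_onb[OF assms(1)] assms(3)
    by (intro onb_total[OF assms(1)] cvs.subspace_diff) (simp_all add: cinner.diff_right)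
  then show ?thesis
    using bessel_identity[OF assms(2) on, of x] by simp
qed

text \<open>Double counting: summing \<open>|\<langle>b, a\<rangle>|\<^sup>2\<close> over \<open>a \<in> A\<close>, \<open>b \<in> B\<close> gives \<open>card A\<close> by Parseval for
  \<open>B\<close> and at most \<open>card B\<close> by Bessel for \<open>A\<close>.\<close>

lemma card_orthonormal_le:
  assumes "is_onb B M" "finite B" "orthonormal A" "A \<subseteq> M" "finite A"
  shows "card A \<le> card B"
proof -
  have one: "(norm x)\<^sup>2 = 1" if "orthonormal C" "x \<in> C" for C and x :: 'a
  proof -
    have "cinner x x = 1"
      using that by (auto simp: orthonormal_def)
    then show ?thesis
      by (metis cinner_self of_real_eq_1_iff)
  qed
  have "real (card A) = (\<Sum>a\<in>A. (norm a)\<^sup>2)"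
    using one[OF assms(3)] by simp
  also have "\<dots> = (\<Sum>a\<in>A. \<Sum>b\<in>B. (cmod (cinner b a))\<^sup>2)"
    using assms(4) by (intro sum.cong refl parseval_finite[OF assms(1,2)]) auto
  also have "\<dots> = (\<Sum>b\<in>B. \<Sum>a\<in>A. (cmod (cinner b a))\<^sup>2)"
    by (rule sum.swap)
  also have "\<dots> = (\<Sum>b\<in>B. \<Sum>a\<in>A. (cmod (cinner a b))\<^sup>2)"
    by (intro sum.cong refl arg_cong[where f = "\<lambda>t. t\<^sup>2"] cmod_cinner_commute)
  also have "\<dots> \<le> (\<Sum>b\<in>B. (norm b)\<^sup>2)"
    by (intro sum_mono bessel_inequality assms)
  also have "\<dots> = real (card B)"
    using one[of B] assms(1) by (simp add: is_onb_iff)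
  finally show ?thesis by simp
qed

text \<open>Bessel's inequality allows only finitely many a with |<a, x>|^2 above a given threshold;
  the thresholds 1/(k+1) exhaust the support.\<close>

lemma countable_orthonormal_support:
  assumes "orthonormal A"
  shows "countable {a\<in>A. cinner a x \<noteq> 0}"
proof -
  define S where "S k = {a\<in>A. inverse (real (Suc k)) < (cmod (cinner a x))\<^sup>2}" for k
  have "finite (S k)" for k
  proof (rule ccontr)
    define e where "e = inverse (real (Suc k))"
    have "0 < e" by (simp add: e_def)
    obtain N :: nat where N: "(norm x)\<^sup>2 < of_nat N * e"
      using ex_less_of_nat_mult[OF \<open>0 < e\<close>] by blast
    assume "infinite (S k)"
    then obtain F where F: "F \<subseteq> S k" "finite F" "card F = N"
      using infinite_arbitrarily_large by blast
    have "of_nat N * e = (\<Sum>a\<in>F. e)"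
      using F by simp
    also have "\<dots> \<le> (\<Sum>a\<in>F. (cmod (cinner a x))\<^sup>2)"
      using F by (intro sum_mono) (auto simp: S_def e_def)
    also have "\<dots> \<le> (norm x)\<^sup>2"
      using F assms by (intro bessel_inequality) (auto simp: S_def intro: orthonormal_subset)
    finally show False using N by simp
  qed
  moreover have "{a\<in>A. cinner a x \<noteq> 0} \<subseteq> (\<Union>k. S k)"
  proof
    fix a assume a: "a \<in> {a\<in>A. cinner a x \<noteq> 0}"
    then have "0 < (cmod (cinner a x))\<^sup>2" by simp
    then obtain k where "inverse (real (Suc k)) < (cmod (cinner a x))\<^sup>2"
      using reals_Archimedean by blast
    then show "a \<in> (\<Union>k. S k)"
      using a by (auto simp: S_def)
  qed
  ultimately show ?thesis
    by (meson countable_UN countable_finite countable_subset countableI_type)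
qed

text \<open>For finite B the double counting bound applies. For infinite B, each a in A is nonzero
  and so not orthogonal to some b in B; thus A is a union over B of countable sets and has
  cardinality at most that of B.\<close>

lemma card_of_orthonormal_le:
  assumes "is_onb B M" "orthonormal A" "A \<subseteq> M"
  shows "(card_of A, card_of B) \<in> ordLeq"
proof (cases "finite B")
  case True
  have "finite A"
  proof (rule ccontr)
    assume "infinite A"
    \<comment> \<open>The counting bound concerns finite sets, so an infinite A is refuted by a
      finite subset with one element too many.\<close>
    then obtain F where F: "F \<subseteq> A" "finite F" "card F = Suc (card B)"
      using infinite_arbitrarily_large by blast
    then show False
      using card_orthonormal_le[OF assms(1) True orthonormal_subset[OF assms(2)], of F] assms(3)
      by auto
  qed
  then show ?thesis
    using card_orthonormal_le[OF assms(1) True assms(2,3)] True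
    by (metis card_of_ordLeq inj_on_iff_card_le)
next
  case False
  have "A \<subseteq> (\<Union>b\<in>B. {a\<in>A. cinner a b \<noteq> 0})"
  proof
    fix a assume a: "a \<in> A"
    have "cinner a a = 1"
      using a assms(2) by (simp add: orthonormal_def)
    then have "a \<noteq> 0" by auto
    then obtain b where "b \<in> B" "cinner b a \<noteq> 0"
      using onb_total[OF assms(1)] a assms(3) by blast
    then show "a \<in> (\<Union>b\<in>B. {a\<in>A. cinner a b \<noteq> 0})"
      using a cinner_eq_0_commute by auto
  qed
  then have "(card_of A, card_of (\<Union>b\<in>B. {a\<in>A. cinner a b \<noteq> 0})) \<in> ordLeq"
    by (rule card_of_mono1)
  moreover have "(card_of {a\<in>A. cinner a b \<noteq> 0}, card_of B) \<in> ordLeq" for b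
  proof -
    have "(card_of {a\<in>A. cinner a b \<noteq> 0}, card_of (UNIV :: nat set)) \<in> ordLeq"
      using countable_orthonormal_support[OF assms(2)]
      by (auto simp: countable_def card_of_ordLeq[symmetric])
    moreover have "(card_of (UNIV :: nat set), card_of B) \<in> ordLeq"
      using False by (simp add: infinite_iff_card_of_nat)
    ultimately show ?thesis
      by (rule ordLeq_transitive)
  qed
  then have "(card_of (\<Union>b\<in>B. {a\<in>A. cinner a b \<noteq> 0}), card_of B) \<in> ordLeq"
    by (rule card_of_UNION_ordLeq_infinite[OF False ordIso_imp_ordLeq[OF card_of_refl] ballI])
  ultimately show ?thesis
    by (rule ordLeq_transitive)
qed

lemma onb_card_of_ordIso:
  assumes "is_onb B M" "is_onb C M"
  shows "(card_of B, card_of C) \<in> ordIso"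
proof -
  have "orthonormal B" "orthonormal C"
    using assms by (simp_all add: is_onb_iff)
  then show ?thesis
    unfolding ordIso_iff_ordLeq
    by (intro conjI card_of_orthonormal_le[OF assms(1)] card_of_orthonormal_le[OF assms(2)]
        onb_subset[OF assms(1)] onb_subset[OF assms(2)])
qed

section \<open>Existence of orthonormal bases and comparison of dimensions\<close>

lemma complex_projection_exists:
  assumes "closed M" "cvs.subspace M"
  shows "\<exists>p\<in>M. x - p \<in> orth_compl M"
proof -
  obtain p where p: "p \<in> M" "\<And>y. y \<in> M \<Longrightarrow> inner (x - p) y = 0"
    using orthogonal_projection_exists[OF assms(1) subspace_of_csubspace[OF assms(2)]] by blast
  \<comment> \<open>M is a complex subspace, so real orthogonality holds against both y and
    iy.\<close>
  have "cinner (x - p) y = 0" if "y \<in> M" for y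
    using p(2)[OF that] p(2)[OF cvs.subspace_scale[OF assms(2) that, of \<i>]]
    by (simp add: complex_eq_iff Re_cinner Im_cinner)
  then show ?thesis
    using p(1) by (auto simp: orth_compl_def cinner_eq_0_commute)
qed

text \<open>Projecting x in M onto the closed span of B leaves a remainder in M orthogonal to B,
  which is zero by totality.\<close>

lemma onb_of_total:
  assumes "closed M" "cvs.subspace M" "B \<subseteq> M" "orthonormal B"
    and total: "\<And>x. x \<in> M \<Longrightarrow> (\<And>b. b \<in> B \<Longrightarrow> cinner b x = 0) \<Longrightarrow> x = 0"
  shows "is_onb B M"
proof -
  let ?N = "closure (cspan B)"
  have "?N \<subseteq> M"
    by (rule closure_cspan_subset[OF assms(1-3)])
  moreover have "x \<in> ?N" if x: "x \<in> M" for x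
  proof -
    obtain p where p: "p \<in> ?N" "x - p \<in> orth_compl ?N"
      using complex_projection_exists[OF closed_closure csubspace_closure[OF cvs.subspace_span]]
      by blast
    have "x - p \<in> M"
      using x p(1) \<open>?N \<subseteq> M\<close> assms(2) by (blast intro: cvs.subspace_diff)
    moreover have "cinner b (x - p) = 0" if "b \<in> B" for b
      using p(2) that unfolding orth_compl_closure_cspan by (simp add: orth_compl_def)
    ultimately have "x - p = 0"
      by (rule total)
    then show ?thesis
      using p(1) by simp
  qed
  ultimately show ?thesis
    using assms(4) by (auto simp: is_onb_iff)
qed

text \<open>Zorn gives a maximal orthonormal subset of M. It is total, since a nonzero vector
  orthogonal to it could be normalized and added.\<close>

lemma onb_exists:
  assumes "closed M" "cvs.subspace M"
  shows "\<exists>B. is_onb B M"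
proof -
  let ?A = "{B. B \<subseteq> M \<and> orthonormal B}"
  have "\<Union>C \<in> ?A" if C: "subset.chain ?A C" for C
  proof -
    have "cinner x y = (if x = y then 1 else 0)" if xy: "x \<in> \<Union>C" "y \<in> \<Union>C" for x y
    proof -
      obtain X Y where XY: "x \<in> X" "X \<in> C" "y \<in> Y" "Y \<in> C"
        using xy by blast
      then have "X \<subseteq> Y \<or> Y \<subseteq> X"
        using C by (auto simp: subset_chain_def)
      then obtain Z where "Z \<in> C" "x \<in> Z" "y \<in> Z"
        using XY by blast
      moreover from this have "orthonormal Z"
        using C by (auto simp: subset_chain_def)
      ultimately show ?thesis
        by (simp add: orthonormal_def)
    qed
    then show ?thesis
      using C by (auto simp: subset_chain_def orthonormal_def)
  qed
  then obtain B where B: "B \<subseteq> M" "orthonormal B"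
    and max: "\<And>X. X \<subseteq> M \<Longrightarrow> orthonormal X \<Longrightarrow> B \<subseteq> X \<Longrightarrow> X = B"
    using subset_Zorn'[of ?A] by (metis (no_types, lifting) mem_Collect_eq)
  have "z = 0" if z: "z \<in> M" "\<And>b. b \<in> B \<Longrightarrow> cinner b z = 0" for z
  proof (rule ccontr)
    assume "z \<noteq> 0"
    define u where "u = complex_of_real (inverse (norm z)) *\<^sub>C z"
    have "u \<in> M"
      unfolding u_def by (rule cvs.subspace_scale[OF assms(2) z(1)])
    have "norm u = 1"
      using \<open>z \<noteq> 0\<close> by (simp add: u_def norm_scaleC norm_inverse)
    then have uu: "cinner u u = 1"
      by (simp add: cinner_self)
    have ub: "cinner b u = 0" "cinner u b = 0" if "b \<in> B" for b
      using z(2)[OF that] cinner_eq_0_commute[of b z]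
      by (auto simp: u_def cinner_scaleC_right cinner_scaleC_left)
    have "orthonormal (insert u B)"
      using B(2) uu ub by (auto simp: orthonormal_def)
    then have "u \<in> B"
      using max[of "insert u B"] \<open>u \<in> M\<close> B(1) by blast
    then show False
      using ub uu by force
  qed
  then show ?thesis
    using onb_of_total[OF assms B(1,2)] by blast
qed

text \<open>\<open>hilbert_dim\<close> uses a basis picked by choice; since all bases of M are
  equipotent, any convenient one computes it.\<close>

lemma hilbert_dim_ordIso:
  assumes "is_onb B M"
  shows "(hilbert_dim M, card_of B) \<in> ordIso"
  unfolding hilbert_dim_def using onb_card_of_ordIso[OF _ assms] someI[of "\<lambda>B. is_onb B M", OF assms]
  by blast

lemma hilbert_dim_eq_iff:
  assumes "is_onb B M" "is_onb C N"
  shows "(hilbert_dim M, hilbert_dim N) \<in> ordIso \<longleftrightarrow> (card_of B, card_of C) \<in> ordIso"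
  using hilbert_dim_ordIso[OF assms(1)] hilbert_dim_ordIso[OF assms(2)]
  by (meson ordIso_symmetric ordIso_transitive)

section \<open>Extending a bijection of orthonormal bases to an isometry\<close>

lemma independent_orthonormal: "orthonormal B \<Longrightarrow> cvs.independent B"
  unfolding cvs.dependent_explicit
  by (metis cinner.zero_right orthonormal_cinner_sum orthonormal_subset)

text \<open>Both sides are sesquilinear in x and y, so agreement on B spreads to the span one
  argument at a time.\<close>

lemma cinner_linear_span:
  assumes h: "Vector_Spaces.linear scaleC scaleC h"
    and B: "\<And>a b. a \<in> B \<Longrightarrow> b \<in> B \<Longrightarrow> cinner (h a) (h b) = cinner a b"
    and x: "x \<in> cspan B" and y: "y \<in> cspan B"
  shows "cinner (h x) (h y) = cinner x y"
proof -
  interpret Vector_Spaces.linear scaleC scaleC h by fact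
  have xb: "cinner (h x) (h b) = cinner x b" if b: "b \<in> B" for b
    using x
  proof (induction rule: cvs.span_induct)
    case base
    show ?case
      using b B by (auto simp: cvs.subspace_def add scale zero cinner_add_left cinner_scaleC_left)
  qed (use b B in auto)
  show ?thesis
    using y
  proof (induction rule: cvs.span_induct)
    case base
    show ?case
      by (auto simp: cvs.subspace_def add scale zero cinner_add_right cinner_scaleC_right)
  qed (rule xb)
qed

text \<open>The bijection extends linearly to the algebraic span, where it is isometric, and then by
  limits to the closure. All properties of g are relative to M.\<close>

lemma isometric_extension:
  fixes f :: "'a::chilbert_space \<Rightarrow> 'b::chilbert_space"
  assumes "is_onb B M" "is_onb C N" "bij_betw f B C"
  shows "\<exists>g. (\<forall>x\<in>M. \<forall>y\<in>M. g (x + y) = g x + g y \<and> cinner (g x) (g y) = cinner x y) \<and>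
    (\<forall>c. \<forall>x\<in>M. g (c *\<^sub>C x) = c *\<^sub>C g x) \<and> g ` M \<subseteq> N \<and> (\<forall>b\<in>B. g b = f b)"
proof -
  have on: "orthonormal B" "orthonormal C" and M: "closure (cspan B) = M"
    and N: "closure (cspan C) = N"
    using assms by (simp_all add: is_onb_iff)
  obtain h where h: "Vector_Spaces.linear scaleC scaleC h" "\<And>b. b \<in> B \<Longrightarrow> h b = f b"
    using cvp.linear_independent_extend[OF independent_orthonormal[OF on(1)], of f] by blast
  interpret h: Vector_Spaces.linear scaleC scaleC h by (rule h(1))
  have fC: "f b \<in> C" if "b \<in> B" for b
    using assms(3) that by (auto simp: bij_betw_def)
  have "f a = f b \<longleftrightarrow> a = b" if "a \<in> B" "b \<in> B" for a b
    using assms(3) that by (auto simp: bij_betw_def inj_on_def)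
  then have hB: "cinner (h a) (h b) = cinner a b" if "a \<in> B" "b \<in> B" for a b
    using on that fC by (simp add: h(2) orthonormal_def)
  have iso: "cinner (h x) (h y) = cinner x y" if "x \<in> cspan B" "y \<in> cspan B" for x y
    by (rule cinner_linear_span[OF h(1) hB that])
  then have normh: "norm (h x) = norm x" if "x \<in> cspan B" for x
    using that by (simp add: norm_eq_sqrt_inner inner_cinner)
  have hN: "h x \<in> N" if "x \<in> cspan B" for x
  proof -
    have "h ` cspan B = cspan (h ` B)"
      by (simp add: h.span_image)
    also have "\<dots> \<subseteq> cspan C"
      using fC h(2) by (intro cvs.span_mono) auto
    finally show ?thesis
      using that closure_subset[of "cspan C"] N by auto
  qed
  \<comment> \<open>Sequences in the span that approximate x. Each property of g below is obtained
    by choosing a suitable such sequence.\<close>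
  define good where "good t x \<longleftrightarrow> (\<forall>k. t k \<in> cspan B) \<and> t \<longlonglongrightarrow> x" for t :: "nat \<Rightarrow> 'a" and x
  have "\<exists>t. good t x" if "x \<in> M" for x
    using that closure_sequential[of x "cspan B"] M by (simp add: good_def)
  then obtain s where s: "\<And>x. x \<in> M \<Longrightarrow> good (s x) x"
    by metis
  define g where "g x = lim (\<lambda>k. h (s x k))" for x
  have hg_s: "(\<lambda>k. h (s x k)) \<longlonglongrightarrow> g x" if "x \<in> M" for x
  proof -
    have "norm (h (s x i) - h (s x j)) = norm (s x i - s x j)" for i j
      using s[OF that] normh[OF cvs.span_diff, of "s x i" "s x j"]
      by (simp add: good_def h.diff)
    then have "Cauchy (\<lambda>k. h (s x k)) \<longleftrightarrow> Cauchy (s x)"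
      by (simp add: Cauchy_def dist_norm)
    moreover have "Cauchy (s x)"
      using s[OF that] LIMSEQ_imp_Cauchy by (auto simp: good_def)
    ultimately show ?thesis
      by (simp add: g_def Cauchy_convergent_iff convergent_LIMSEQ_iff)
  qed
  \<comment> \<open>The value g x is independent of the approximating sequence: two of them differ
    by a null sequence, and h preserves norms.\<close>
  have hg: "(\<lambda>k. h (t k)) \<longlonglongrightarrow> g x" if "good t x" "x \<in> M" for t x
  proof -
    have "(\<lambda>k. t k - s x k) \<longlonglongrightarrow> 0"
      using tendsto_diff[of t x _ "s x" x] that(1) s[OF that(2)] by (simp add: good_def)
    moreover have "norm (h (t k) - h (s x k)) = norm (t k - s x k)" for k
      using that(1) s[OF that(2)] normh[OF cvs.span_diff, of "t k" "s x k"]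
      by (simp add: good_def h.diff)
    ultimately have "(\<lambda>k. h (t k) - h (s x k)) \<longlonglongrightarrow> 0"
      by (simp only: tendsto_norm_zero_iff[of "\<lambda>k. h (t k) - h (s x k)", symmetric]
          tendsto_norm_zero)
    from tendsto_add[OF this hg_s[OF that(2)]] show ?thesis
      by simp
  qed
  have sM: "cvs.subspace M"
    by (rule csubspace_onb[OF assms(1)])
  have "g (x + y) = g x + g y" if xy: "x \<in> M" "y \<in> M" for x y
  proof -
    have "good (\<lambda>k. s x k + s y k) (x + y)"
      using s[OF xy(1)] s[OF xy(2)] by (auto simp: good_def intro: cvs.span_add tendsto_add)
    from hg[OF this cvs.subspace_add[OF sM xy]]
    have "(\<lambda>k. h (s x k) + h (s y k)) \<longlonglongrightarrow> g (x + y)"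
      by (simp add: h.add)
    then show ?thesis
      using tendsto_add[OF hg_s[OF xy(1)] hg_s[OF xy(2)]] LIMSEQ_unique by blast
  qed
  moreover have "g (c *\<^sub>C x) = c *\<^sub>C g x" if x: "x \<in> M" for c x
  proof -
    have "good (\<lambda>k. c *\<^sub>C s x k) (c *\<^sub>C x)"
      using s[OF x] by (auto simp: good_def intro: cvs.span_scale
          bounded_linear.tendsto[OF bounded_linear_scaleC])
    from hg[OF this cvs.subspace_scale[OF sM x]]
    have "(\<lambda>k. c *\<^sub>C h (s x k)) \<longlonglongrightarrow> g (c *\<^sub>C x)"
      by (simp add: h.scale)
    then show ?thesis
      using bounded_linear.tendsto[OF bounded_linear_scaleC hg_s[OF x]] LIMSEQ_unique by blast
  qed
  moreover have "cinner (g x) (g y) = cinner x y" if xy: "x \<in> M" "y \<in> M" for x y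
  proof -
    have "(\<lambda>k. cinner (h (s x k)) (h (s y k))) \<longlonglongrightarrow> cinner (g x) (g y)"
      by (intro cinner.tendsto hg_s xy)
    moreover have "(\<lambda>k. cinner (h (s x k)) (h (s y k))) = (\<lambda>k. cinner (s x k) (s y k))"
      using s[OF xy(1)] s[OF xy(2)] by (simp add: good_def iso)
    moreover have "(\<lambda>k. cinner (s x k) (s y k)) \<longlonglongrightarrow> cinner x y"
      using s[OF xy(1)] s[OF xy(2)] by (intro cinner.tendsto) (auto simp: good_def)
    ultimately show ?thesis
      using LIMSEQ_unique by metis
  qed
  moreover have "g x \<in> N" if "x \<in> M" for x
    using closed_sequentially[OF _ _ hg_s[OF that]] s[OF that] hN N closed_closure
    by (metis good_def)
  moreover have "g b = f b" if b: "b \<in> B" for b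
  proof -
    have "good (\<lambda>_. b) b"
      using b by (simp add: good_def cvs.span_base)
    from hg[OF this] b onb_subset[OF assms(1)] have "(\<lambda>_. h b) \<longlonglongrightarrow> g b"
      by blast
    then show ?thesis
      using h(2)[OF b] by (simp add: LIMSEQ_const_iff)
  qed
  ultimately show ?thesis
    by (intro exI[of _ g]) blast
qed

section \<open>Families of isometries with orthogonal ranges\<close>

text \<open>The Toeplitz relations read inside B(H), so that the operator arguments make no
  reference to the abstract algebra.\<close>

definition toeplitz_ops :: "nat \<Rightarrow> (nat \<Rightarrow> 'h::chilbert_space \<Rightarrow> 'h) \<Rightarrow> bool" where
  "toeplitz_ops n S \<longleftrightarrow> (\<forall>i\<in>{1..n}. bounded_clinear (S i)) \<and>
     (\<forall>i\<in>{1..n}. \<forall>j\<in>{1..n}. \<forall>x. adj (S i) (S j x) = (if i = j then x else 0))"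

text \<open>Uses the ranges of the generators alone; passing to their linear span leaves the
  orthogonal complement unchanged.\<close>

definition defect_space :: "nat \<Rightarrow> (nat \<Rightarrow> 'h::chilbert_space \<Rightarrow> 'h) \<Rightarrow> 'h set" where
  "defect_space n S = orth_compl {S i h | i h. i \<in> {1..n}}"

lemma defect_space_iff: "x \<in> defect_space n S \<longleftrightarrow> (\<forall>i\<in>{1..n}. \<forall>h. cinner (S i h) x = 0)"
  unfolding defect_space_def orth_compl_def by blast

lemma closed_csubspace_defect_space:
  "closed (defect_space n S)" "cvs.subspace (defect_space n S)"
  by (simp_all add: defect_space_def closed_csubspace_orth_compl)

text \<open>The ranges of the isometries are mutually orthogonal and orthogonal to k and l, so all
  cross terms vanish. Applied to both families, it shows that the intertwiner preserves inner
  products.\<close>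

lemma toeplitz_ops_cinner:
  assumes S: "toeplitz_ops n S" and k: "k \<in> defect_space n S" and l: "l \<in> defect_space n S"
  shows "cinner ((\<Sum>i=1..n. S i (a i)) + k) ((\<Sum>i=1..n. S i (b i)) + l)
    = (\<Sum>i=1..n. cinner (a i) (b i)) + cinner k l"
proof -
  have bc: "bounded_clinear (S i)" if "i \<in> {1..n}" for i
    using S that by (simp add: toeplitz_ops_def)
  have "cinner (S i (a i)) (\<Sum>j=1..n. S j (b j)) = cinner (a i) (b i)" if i: "i \<in> {1..n}" for i
  proof -
    have "cinner (S i (a i)) (\<Sum>j=1..n. S j (b j))
        = cinner (a i) (\<Sum>j=1..n. adj (S i) (S j (b j)))"
      by (simp add: cinner.sum_right cinner_adj_right bc[OF i])
    also have "(\<Sum>j=1..n. adj (S i) (S j (b j))) = (\<Sum>j=1..n. if i = j then b j else 0)"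
      using S i by (intro sum.cong) (auto simp: toeplitz_ops_def)
    finally show ?thesis
      using i by simp
  qed
  moreover have "cinner (S i h) l = 0" "cinner k (S i h) = 0" if "i \<in> {1..n}" for i h
    using k l that by (simp_all add: defect_space_iff cinner_eq_0_commute[of k])
  ultimately show ?thesis
    by (simp add: cinner_add_left cinner_add_right cinner.sum_left cinner.sum_right[of k])
qed

text \<open>Surjectivity enters as triviality of the complement of the range: W (adj W y) - y is
  orthogonal to every W x because W preserves inner products.\<close>

lemma unitary_opI:
  assumes lin: "\<And>x y. W (x + y) = W x + W y" "\<And>c x. W (c *\<^sub>C x) = c *\<^sub>C W x"
    and iso: "\<And>x y. cinner (W x) (W y) = cinner x y"
    and total: "\<And>y. (\<And>x. cinner (W x) y = 0) \<Longrightarrow> y = 0"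
  shows "unitary_op W"
proof -
  have "norm (W x) = norm x" for x
    by (simp add: norm_eq_sqrt_inner inner_cinner iso)
  then have bc: "bounded_clinear W"
    unfolding bounded_clinear_def
    by (intro conjI bounded_linear_intro[where K = 1]) (simp_all add: lin scaleR_scaleC)
  have "cinner z (adj W (W x)) = cinner z x" for x z
    by (simp add: cinner_adj_right bc iso)
  then have 1: "adj W (W x) = x" for x
    using cinner_cancel_left by blast
  have "W (adj W y) - y = 0" for y
    by (rule total) (simp add: cinner.diff_right iso cinner_adj_right bc)
  then show ?thesis
    by (simp add: unitary_op_def bc fun_eq_iff 1)
qed

text \<open>Surjectivity of W is read off from orthogonality. A vector orthogonal to the range of W
  is orthogonal to every \<open>S i h\<close>, hence lies in the defect space of S; it is also
  orthogonal to the basis C, the image of B under W, so it is zero.\<close>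

lemma intertwining_unitary:
  assumes S: "toeplitz_ops n S" and T: "toeplitz_ops n T"
    and dim: "(hilbert_dim (defect_space n S), hilbert_dim (defect_space n T)) \<in> ordIso"
  shows "\<exists>W. unitary_op W \<and> (\<forall>i\<in>{1..n}. \<forall>h. W (T i h) = S i h)"
proof -
  let ?M = "defect_space n T" and ?N = "defect_space n S"
  obtain B C where B: "is_onb B ?M" and C: "is_onb C ?N"
    using onb_exists[OF closed_csubspace_defect_space[of n T]]
      onb_exists[OF closed_csubspace_defect_space[of n S]] by blast
  have "(card_of B, card_of C) \<in> ordIso"
    using dim hilbert_dim_eq_iff[OF C B] ordIso_symmetric by blast
  then obtain f where f: "bij_betw f B C"
    by (auto simp: card_of_ordIso[symmetric])
  obtain g where "(\<forall>x\<in>?M. \<forall>y\<in>?M. g (x + y) = g x + g y \<and> cinner (g x) (g y) = cinner x y) \<and>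
    (\<forall>c. \<forall>x\<in>?M. g (c *\<^sub>C x) = c *\<^sub>C g x) \<and> g ` ?M \<subseteq> ?N \<and> (\<forall>b\<in>B. g b = f b)"
    using isometric_extension[OF B C f] by (rule exE)
  then have g: "\<And>x y. x \<in> ?M \<Longrightarrow> y \<in> ?M \<Longrightarrow> g (x + y) = g x + g y"
    "\<And>x y. x \<in> ?M \<Longrightarrow> y \<in> ?M \<Longrightarrow> cinner (g x) (g y) = cinner x y"
    "\<And>c x. x \<in> ?M \<Longrightarrow> g (c *\<^sub>C x) = c *\<^sub>C g x"
    "\<And>x. x \<in> ?M \<Longrightarrow> g x \<in> ?N" "\<And>b. b \<in> B \<Longrightarrow> g b = f b"
    by blast+
  have bS: "bounded_clinear (S i)" and bT: "bounded_clinear (T i)"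
    and bT': "bounded_clinear (adj (T i))" if "i \<in> {1..n}" for i
    using S T that by (auto simp: toeplitz_ops_def bounded_clinear_adj)
  have TT: "adj (T i) (T j h) = (if i = j then h else 0)" if "i \<in> {1..n}" "j \<in> {1..n}" for i j h
    using T that by (simp add: toeplitz_ops_def)
  define Q where "Q x = x - (\<Sum>i=1..n. T i (adj (T i) x))" for x
  define W where "W x = (\<Sum>i=1..n. S i (adj (T i) x)) + g (Q x)" for x
  have decomp: "x = (\<Sum>i=1..n. T i (adj (T i) x)) + Q x" for x
    by (simp add: Q_def)
  have Q: "Q x \<in> ?M" for x
    unfolding defect_space_iff
  proof (intro ballI allI)
    fix i h assume i: "i \<in> {1..n}"
    have "adj (T i) (\<Sum>j=1..n. T j (adj (T j) x)) = (\<Sum>j=1..n. if i = j then adj (T j) x else 0)"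
      unfolding bounded_clinear_sum[OF bT'[OF i]] using i by (intro sum.cong) (auto simp: TT)
    then have "adj (T i) (Q x) = 0"
      using i by (simp add: Q_def bounded_clinear_diff bT')
    then show "cinner (T i h) (Q x) = 0"
      by (metis bT[OF i] cinner_adj_right cinner.zero_right)
  qed
  have Q_add: "Q (x + y) = Q x + Q y" for x y
    by (simp add: Q_def bounded_clinear_add bT bT' sum.distrib)
  have Q_scale: "Q (c *\<^sub>C x) = c *\<^sub>C Q x" for c x
    by (simp add: Q_def bounded_clinear_scaleC bT bT' cvs.scale_sum_right
        cvs.scale_right_diff_distrib)
  have WT: "W (T i h) = S i h" if i: "i \<in> {1..n}" for i h
  proof -
    \<comment> \<open>Used twice: R = S evaluates the sum in W, and R = T shows that Q kills
      \<open>T i h\<close>.\<close>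
    have "(\<Sum>j=1..n. R j (adj (T j) (T i h))) = R i h"
      if "\<And>j. j \<in> {1..n} \<Longrightarrow> bounded_clinear (R j)" for R
    proof -
      have "(\<Sum>j=1..n. R j (adj (T j) (T i h))) = (\<Sum>j=1..n. if j = i then R j h else 0)"
        using i that by (intro sum.cong) (auto simp: TT bounded_clinear_zero)
      then show ?thesis using i by simp
    qed
    from this[of S] this[of T] have "W (T i h) = S i h + g 0"
      using bS bT by (simp add: W_def Q_def)
    moreover have "g 0 = 0"
      using g(1)[of 0 0] cvs.subspace_0[OF closed_csubspace_defect_space(2), of n T] by simp
    ultimately show ?thesis by simp
  qed
  \<comment> \<open>On the defect space of T all \<open>adj (T i)\<close> vanish, so Q is the
    identity and W agrees with g there.\<close>
  have WB: "W b = f b" if b: "b \<in> B" for b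
  proof -
    have "b \<in> ?M"
      using b onb_subset[OF B] by blast
    then have "cinner h (adj (T i) b) = 0" if "i \<in> {1..n}" for i h
      using that by (simp add: cinner_adj_right bT defect_space_iff)
    then have "adj (T i) b = 0" if "i \<in> {1..n}" for i
      using that cinner_self_eq_zero by blast
    then show ?thesis
      using g(5)[OF b] by (simp add: W_def Q_def bounded_clinear_zero bS bT)
  qed
  have "unitary_op W"
  proof (rule unitary_opI)
    show "W (x + y) = W x + W y" for x y
      by (simp add: W_def Q_add g(1) Q bounded_clinear_add bS bT' sum.distrib)
    show "W (c *\<^sub>C x) = c *\<^sub>C W x" for c x
      by (simp add: W_def Q_scale g(3) Q bounded_clinear_scaleC bS bT' cvs.scale_sum_right
          scaleC_add_right)
    show "cinner (W x) (W y) = cinner x y" for x y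
    proof -
      have "cinner (W x) (W y) = (\<Sum>i=1..n. cinner (adj (T i) x) (adj (T i) y)) + cinner (Q x) (Q y)"
        unfolding W_def using toeplitz_ops_cinner[OF S] g(2,4) Q by simp
      also have "\<dots> = cinner ((\<Sum>i=1..n. T i (adj (T i) x)) + Q x)
          ((\<Sum>i=1..n. T i (adj (T i) y)) + Q y)"
        using toeplitz_ops_cinner[OF T] Q by simp
      finally show ?thesis
        by (simp only: decomp[symmetric])
    qed
    show "y = 0" if y: "\<And>x. cinner (W x) y = 0" for y
    proof (rule onb_total[OF C])
      show "y \<in> ?N"
        unfolding defect_space_iff by (metis WT y)
      show "cinner c y = 0" if "c \<in> C" for c
        using f that WB y by (metis bij_betw_iff_bijections)
    qed
  qed
  then show ?thesis
    using WT by blast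
qed

section \<open>Free and quasifree equivalence over B(H)\<close>

lemma carrier_BH: "T \<in> carrier BH \<longleftrightarrow> bounded_clinear T"
  by (simp add: BH_def)

lemma unitary_opD:
  assumes "unitary_op W"
  shows "bounded_clinear W" "adj W (W x) = x" "W (adj W x) = x"
  using assms by (simp_all add: unitary_op_def fun_eq_iff)

lemma unitary_op_adj: "unitary_op W \<Longrightarrow> unitary_op (adj W)"
  by (simp add: unitary_op_def bounded_clinear_adj adj_adj)

lemma Ad_apply: "Ad W T x = W (T (adj W x))"
  by (simp add: Ad_def)

lemma bounded_clinear_Ad:
  "unitary_op W \<Longrightarrow> bounded_clinear T \<Longrightarrow> bounded_clinear (Ad W T)"
  by (simp add: Ad_def bounded_clinear_o bounded_clinear_adj unitary_opD)

text \<open>Conjugation by \<open>adj W\<close> is the inverse map, so for D = B(H) the fixing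
  condition puts no restriction on a unitary.\<close>

lemma fixing_unitary_BH:
  assumes W: "unitary_op W"
  shows "fixing_unitary (carrier BH) W"
proof -
  note bc = unitary_opD(1)[OF W] bounded_clinear_adj[OF unitary_opD(1)[OF W]]
  have star: "Ad W (adj T) = adj (Ad W T)" if "bounded_clinear T" for T
    by (rule sym, rule adj_eqI)
      (simp_all add: that bc bounded_clinear_Ad W Ad_apply cinner_adj_right
        cinner_adj_left[OF bc(1), symmetric])
  have "star_hom BH BH (Ad W)"
    by (auto simp: star_hom_def BH_def bounded_clinear_Ad W star Ad_apply fun_eq_iff
        bounded_clinear_add bounded_clinear_scaleC bc unitary_opD)
  moreover have "bij_betw (Ad W) (carrier BH) (carrier BH)"
    by (rule bij_betw_byWitness[where f' = "Ad (adj W)"])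
      (auto simp: carrier_BH bounded_clinear_Ad W unitary_op_adj Ad_apply fun_eq_iff
        unitary_opD adj_adj)
  ultimately show ?thesis
    using W by (simp add: fixing_unitary_def star_automorphism_def)
qed

lemma Dn_inner_basis:
  assumes "i \<in> {1..n}" "x \<in> Dn n (carrier BH)"
  shows "Dn_inner n (Dn_basis n i) x = x i"
proof
  fix h
  have "Dn_inner n (Dn_basis n i) x h = (\<Sum>j=1..n. if j = i then x j h else 0)"
    unfolding Dn_inner_def
    by (intro sum.cong) (auto simp: Dn_basis_def adj_id adj_zero)
  then show "Dn_inner n (Dn_basis n i) x h = x i h"
    using assms(1) by simp
qed

lemma sigma_rep_apply:
  "x \<in> Dn n (carrier BH) \<Longrightarrow> sigma_rep n v \<omega> x h = (\<Sum>i=1..n. \<omega> (v i) (x i h))"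
  by (simp add: sigma_rep_def Dn_inner_basis)

lemma Dn_BH_iff:
  "x \<in> Dn n (carrier BH) \<longleftrightarrow> (\<forall>i\<in>{1..n}. bounded_clinear (x i)) \<and> x \<in> extensional {1..n}"
  by (auto simp: Dn_def PiE_iff carrier_BH)

text \<open>Left multiplication by W commutes with the right action of D, and its adjoint and
  inverse is left multiplication by \<open>adj W\<close>.\<close>

lemma unitary_Dn_diagonal:
  assumes W: "unitary_op W"
  shows "unitary_Dn n (carrier BH) (\<lambda>x. \<lambda>i\<in>{1..n}. W \<circ> x i)"
proof -
  let ?D = "Dn n (carrier BH :: ('a \<Rightarrow> 'a) set)"
  define diag where "diag V x = (\<lambda>i\<in>{1..n}. V \<circ> x i)" for V :: "'a \<Rightarrow> 'a" and x :: "nat \<Rightarrow> 'a \<Rightarrow> 'a"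
  have maps: "diag V \<in> ?D \<rightarrow> ?D" if "bounded_clinear V" for V
    using that by (auto simp: diag_def Dn_BH_iff bounded_clinear_o)
  have pair: "Dn_adjoint_pair n (carrier BH) (diag V) (diag (adj V))" if "bounded_clinear V" for V
    using that by (simp add: Dn_adjoint_pair_def Dn_inner_def diag_def Dn_BH_iff adj_o)
  have L: "diag V \<in> L_Dn n (carrier BH)" if V: "bounded_clinear V" for V
  proof -
    have "diag V (Dn_add n x y) = Dn_add n (diag V x) (diag V y)" for x y
      by (auto simp: diag_def Dn_add_def fun_eq_iff bounded_clinear_add[OF V])
    moreover have "diag V (Dn_act n x d) = Dn_act n (diag V x) d" for x d
      by (auto simp: diag_def Dn_act_def fun_eq_iff)
    ultimately show ?thesis
      unfolding L_Dn_def using maps[OF V] maps[OF bounded_clinear_adj[OF V]] pair[OF V] by blast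
  qed
  \<comment> \<open>Equality of module elements is equality of functions on all of nat; outside
    {1..n} it comes from extensionality of x.\<close>
  have inv: "diag V (diag V' x) = x" if "x \<in> ?D" "\<And>h. V (V' h) = h" for V V' x
    using that by (fastforce simp: diag_def Dn_BH_iff fun_eq_iff extensional_def)
  note bc = unitary_opD(1)[OF W]
  have "unitary_Dn n (carrier BH) (diag W)"
    unfolding unitary_Dn_def
    using L[OF bc] L[OF bounded_clinear_adj[OF bc]] pair[OF bc] inv unitary_opD(2,3)[OF W]
    by blast
  then show ?thesis
    by (simp add: diag_def[abs_def])
qed

text \<open>The unitary W carries the defect space of T onto that of the conjugated family, so it
  carries an orthonormal basis to an orthonormal basis.\<close>

lemma hilbert_dim_defect_space_conj:
  assumes W: "unitary_op W" and T: "\<And>i. i \<in> {1..n} \<Longrightarrow> bounded_clinear (T i)"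
  shows "(hilbert_dim (defect_space n (\<lambda>i. Ad W (T i))), hilbert_dim (defect_space n T)) \<in> ordIso"
proof -
  note bc = unitary_opD(1)[OF W]
  obtain B where B: "is_onb B (defect_space n T)"
    using onb_exists[OF closed_csubspace_defect_space[of n T]] by blast
  have iso: "cinner (W x) (W y) = cinner x y" for x y
    by (metis cinner_adj_right[OF bc] unitary_opD(2)[OF W])
  then have inj: "inj W"
    by (metis injI unitary_opD(2)[OF W])
  have mem: "x \<in> defect_space n (\<lambda>i. Ad W (T i)) \<longleftrightarrow> adj W x \<in> defect_space n T" for x
    unfolding defect_space_iff Ad_apply cinner_adj_right[OF bc] by (metis unitary_opD(2)[OF W])
  have "is_onb (W ` B) (defect_space n (\<lambda>i. Ad W (T i)))"
  proof (rule onb_of_total[OF closed_csubspace_defect_space])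
    show "W ` B \<subseteq> defect_space n (\<lambda>i. Ad W (T i))"
      using onb_subset[OF B] by (auto simp: mem unitary_opD[OF W])
    show "orthonormal (W ` B)"
      using B inj by (auto simp: is_onb_iff orthonormal_def iso inj_eq)
    show "x = 0" if "x \<in> defect_space n (\<lambda>i. Ad W (T i))"
      and x: "\<And>b. b \<in> W ` B \<Longrightarrow> cinner b x = 0" for x
    proof -
      have "adj W x = 0"
      proof (rule onb_total[OF B])
        show "adj W x \<in> defect_space n T"
          using that(1) by (simp add: mem)
        show "cinner b (adj W x) = 0" if "b \<in> B" for b
          using x that by (simp add: cinner_adj_right[OF bc])
      qed
      then show ?thesis
        by (metis bounded_clinear_zero[OF bc] unitary_opD(3)[OF W])
    qed
  qed
  moreover have "(card_of (W ` B), card_of B) \<in> ordIso"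
    using inj by (meson card_of_ordIso inj_on_imp_bij_betw inj_on_subset ordIso_symmetric subset_UNIV)
  ultimately show ?thesis
    using hilbert_dim_eq_iff[OF _ B] by blast
qed

text \<open>Evaluating sigma at the basis vector \<open>Dn_basis n i\<close> writes \<omega>(v_i)h
  as a sum of vectors in the ranges of the \<tau>(v_j). The reverse inclusion will come from the
  inverse of U.\<close>

lemma free_equiv_defect_space_subset:
  fixes \<omega> \<tau> :: "'e \<Rightarrow> 'h::chilbert_space \<Rightarrow> 'h"
  assumes bc: "\<And>i. i \<in> {1..n} \<Longrightarrow> bounded_clinear (\<omega> (v i))"
    and U: "U \<in> Dn n (carrier BH) \<rightarrow> Dn n (carrier BH)"
    and sigma: "\<And>x. x \<in> Dn n (carrier BH) \<Longrightarrow> sigma_rep n v \<omega> x = sigma_rep n v \<tau> (U x)"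
  shows "defect_space n (\<lambda>i. \<tau> (v i)) \<subseteq> defect_space n (\<lambda>i. \<omega> (v i))"
proof
  fix y assume y: "y \<in> defect_space n (\<lambda>i. \<tau> (v i))"
  show "y \<in> defect_space n (\<lambda>i. \<omega> (v i))"
    unfolding defect_space_iff
  proof (intro ballI allI)
    fix i h assume i: "i \<in> {1..n}"
    let ?e = "Dn_basis n i :: nat \<Rightarrow> 'h \<Rightarrow> 'h"
    have e: "?e \<in> Dn n (carrier BH)"
      by (auto simp: Dn_BH_iff Dn_basis_def bounded_clinear_id bounded_clinear_const_zero)
    have "sigma_rep n v \<omega> ?e h = (\<Sum>j=1..n. if j = i then \<omega> (v j) h else 0)"
      unfolding sigma_rep_apply[OF e]
      by (intro sum.cong) (auto simp: Dn_basis_def bounded_clinear_zero bc)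
    then have "\<omega> (v i) h = sigma_rep n v \<tau> (U ?e) h"
      using i sigma[OF e] by simp
    also have "\<dots> = (\<Sum>j=1..n. \<tau> (v j) (U ?e j h))"
      using U e by (intro sigma_rep_apply) blast
    finally show "cinner (\<omega> (v i) h) y = 0"
      using y by (simp add: cinner.sum_left defect_space_iff)
  qed
qed

section \<open>Representations of the Toeplitz algebra\<close>

lemma star_hom_BH_finsum:
  assumes "cstar_algebra E" "star_hom E BH \<omega>" "finite I" "f \<in> I \<rightarrow> carrier E"
  shows "\<omega> (finsum E f I) h = (\<Sum>i\<in>I. \<omega> (f i) h)"
proof -
  interpret E: cstar_algebra E by fact
  have add: "\<omega> (x \<oplus>\<^bsub>E\<^esub> y) = (\<lambda>h. \<omega> x h + \<omega> y h)" if "x \<in> carrier E" "y \<in> carrier E" for x y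
    using assms(2) that by (simp add: star_hom_def BH_def)
  show ?thesis
    using assms(3,4)
  proof (induction I)
    case empty
    \<comment> \<open>\<open>star_hom\<close> states additivity only for two summands; the value at
      zero follows from 0 = 0 + 0.\<close>
    have "\<omega> \<zero>\<^bsub>E\<^esub> h = \<omega> \<zero>\<^bsub>E\<^esub> h + \<omega> \<zero>\<^bsub>E\<^esub> h"
      using fun_cong[OF add[of "\<zero>\<^bsub>E\<^esub>" "\<zero>\<^bsub>E\<^esub>"], of h] by simp
    then show ?case by simp
  next
    case (insert i I)
    then show ?case
      by (simp add: E.finsum_insert add Pi_iff)
  qed
qed

text \<open>\<open>star_hom\<close> does not ask for unitality. The fixed vectors of \<omega>(1)
  form a closed subspace containing every \<omega>(a)h, and nondegeneracy makes it all of H.\<close>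

lemma nondeg_rep_one:
  assumes "cstar_algebra E" "nondeg_rep E \<omega>"
  shows "\<omega> \<one>\<^bsub>E\<^esub> = id"
proof -
  interpret E: cstar_algebra E by fact
  have hom: "star_hom E BH \<omega>" and dense: "closure (cspan {\<omega> a h | a h. a \<in> carrier E}) = UNIV"
    using assms(2) by (simp_all add: nondeg_rep_def)
  have bc: "bounded_clinear (\<omega> \<one>\<^bsub>E\<^esub>)"
    using hom by (auto simp: star_hom_def BH_def)
  have "\<omega> \<one>\<^bsub>E\<^esub> (\<omega> a h) = \<omega> a h" if a: "a \<in> carrier E" for a h
  proof -
    have "\<omega> (x \<otimes>\<^bsub>E\<^esub> y) = \<omega> x \<circ> \<omega> y" if "x \<in> carrier E" "y \<in> carrier E" for x y
      using hom that by (simp add: star_hom_def BH_def)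
    from fun_cong[OF this[OF _ a, of "\<one>\<^bsub>E\<^esub>"], of h] show ?thesis
      using a by simp
  qed
  then have "{\<omega> a h | a h. a \<in> carrier E} \<subseteq> {x. \<omega> \<one>\<^bsub>E\<^esub> x = x}"
    by auto
  moreover have "closed {x. \<omega> \<one>\<^bsub>E\<^esub> x = x}"
    using bc by (intro closed_Collect_eq continuous_intros linear_continuous_on)
      (simp add: bounded_clinear_def)
  moreover have "cvs.subspace {x. \<omega> \<one>\<^bsub>E\<^esub> x = x}"
    using bc by (simp add: cvs.subspace_def bounded_clinear_zero bounded_clinear_add
        bounded_clinear_scaleC)
  ultimately have "\<omega> \<one>\<^bsub>E\<^esub> x = x" for x
    using closure_cspan_subset dense by blast
  then show ?thesis by auto
qed

lemma toeplitz_ops_rep: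
  assumes "toeplitz_algebra n E v" "nondeg_rep E \<omega>"
  shows "toeplitz_ops n (\<lambda>i. \<omega> (v i))"
proof -
  have E: "cstar_algebra E"
    using assms(1) by (simp add: toeplitz_algebra_def)
  interpret E: cstar_algebra E by (rule E)
  have hom: "star_hom E BH \<omega>"
    using assms(2) by (simp add: nondeg_rep_def)
  have v: "v i \<in> carrier E" if "i \<in> {1..n}" for i
    using assms(1) that by (simp add: toeplitz_algebra_def toeplitz_family_def)
  have "adj (\<omega> (v i)) (\<omega> (v j) x) = (if i = j then x else 0)"
    if ij: "i \<in> {1..n}" "j \<in> {1..n}" for i j x
  proof -
    have "adj (\<omega> (v i)) \<circ> \<omega> (v j) = \<omega> (star E (v i) \<otimes>\<^bsub>E\<^esub> v j)"
      using hom v ij E.star_closed by (simp add: star_hom_def BH_def)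
    also have "star E (v i) \<otimes>\<^bsub>E\<^esub> v j = (if i = j then \<one>\<^bsub>E\<^esub> else \<zero>\<^bsub>E\<^esub>)"
      using assms(1) ij by (simp add: toeplitz_algebra_def toeplitz_family_def)
    finally have "adj (\<omega> (v i)) (\<omega> (v j) x) = \<omega> (if i = j then \<one>\<^bsub>E\<^esub> else \<zero>\<^bsub>E\<^esub>) x"
      by (simp add: fun_eq_iff)
    then show ?thesis
      \<comment> \<open>The empty sum gives \<omega>(0) = 0, which settles the case of distinct
        indices.\<close>
      using nondeg_rep_one[OF E assms(2)] star_hom_BH_finsum[OF E hom, of "{}" undefined x] by auto
  qed
  then show ?thesis
    using hom v by (auto simp: toeplitz_ops_def star_hom_def BH_def)
qed

lemma rep_multiplicity_eq_hilbert_dim: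
  assumes "toeplitz_algebra n E v" "nondeg_rep E \<omega>"
  shows "rep_multiplicity n E v \<omega> = hilbert_dim (defect_space n (\<lambda>i. \<omega> (v i)))"
proof -
  have E: "cstar_algebra E"
    using assms(1) by (simp add: toeplitz_algebra_def)
  interpret E: cstar_algebra E by (rule E)
  have hom: "star_hom E BH \<omega>"
    using assms(2) by (simp add: nondeg_rep_def)
  have v: "v i \<in> carrier E" if "i \<in> {1..n}" for i
    using assms(1) that by (simp add: toeplitz_algebra_def toeplitz_family_def)
  let ?a = "\<lambda>c. finsum E (\<lambda>i. c i \<odot>\<^bsub>E\<^esub> v i) {1..n}"
  have lincomb: "\<omega> (?a c) h = (\<Sum>i=1..n. c i *\<^sub>C \<omega> (v i) h)" for c h
  proof -
    have "c i \<odot>\<^bsub>E\<^esub> v i \<in> carrier E" if "i \<in> {1..n}" for i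
      using E.smult_closed[of "c i"] v[OF that] by (simp add: complex_ring_def)
    then have "\<omega> (?a c) h = (\<Sum>i=1..n. \<omega> (c i \<odot>\<^bsub>E\<^esub> v i) h)"
      by (intro star_hom_BH_finsum[OF E hom]) auto
    also have "\<dots> = (\<Sum>i=1..n. c i *\<^sub>C \<omega> (v i) h)"
      using hom v by (intro sum.cong) (auto simp: star_hom_def BH_def)
    finally show ?thesis .
  qed
  have "orth_compl {\<omega> a h | a h. a \<in> gen_span n E v} = defect_space n (\<lambda>i. \<omega> (v i))"
  proof (intro equalityI subsetI)
    fix x assume x: "x \<in> orth_compl {\<omega> a h | a h. a \<in> gen_span n E v}"
    show "x \<in> defect_space n (\<lambda>i. \<omega> (v i))"
      unfolding defect_space_iff
    proof (intro ballI allI)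
      fix i h assume i: "i \<in> {1..n}"
      \<comment> \<open>Kronecker coefficients exhibit v_i itself as an element of the span.\<close>
      let ?c = "\<lambda>j. if j = i then 1 else 0 :: complex"
      have "\<omega> (?a ?c) h = (\<Sum>j=1..n. if j = i then \<omega> (v j) h else 0)"
        unfolding lincomb by (intro sum.cong) auto
      then have "\<omega> (v i) h = \<omega> (?a ?c) h"
        using i by simp
      moreover have "?a ?c \<in> gen_span n E v"
        using rangeI[of ?a ?c] by (simp only: gen_span_def)
      ultimately show "cinner (\<omega> (v i) h) x = 0"
        using x by (auto simp: orth_compl_def)
    qed
  next
    fix x assume "x \<in> defect_space n (\<lambda>i. \<omega> (v i))"
    then have "cinner (\<omega> (?a c) h) x = 0" for c h
      unfolding lincomb by (simp add: cinner.sum_left cinner_scaleC_left defect_space_iff)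
    then show "x \<in> orth_compl {\<omega> a h | a h. a \<in> gen_span n E v}"
      unfolding orth_compl_def gen_span_def by blast
  qed
  then show ?thesis
    by (simp add: rep_multiplicity_def)
qed

theorem theorem3p2:
  fixes n :: nat
    and E :: "'e cstar" and v :: "nat \<Rightarrow> 'e"
    and \<omega> \<tau> :: "'e \<Rightarrow> 'h::chilbert_space \<Rightarrow> 'h"
  assumes "1 \<le> n"
    and "toeplitz_algebra n E v"
    and "nondeg_rep E \<omega>" and "nondeg_rep E \<tau>"
  shows "quasifree_equiv n v (carrier BH) \<omega> \<tau> \<longleftrightarrow>
    (rep_multiplicity n E v \<omega>, rep_multiplicity n E v \<tau>) \<in> ordIso"
proof -
  let ?S = "\<lambda>i. \<omega> (v i)" and ?T = "\<lambda>i. \<tau> (v i)"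
  have S: "toeplitz_ops n ?S" and T: "toeplitz_ops n ?T"
    using toeplitz_ops_rep assms by blast+
  then have bS: "bounded_clinear (?S i)" and bT: "bounded_clinear (?T i)" if "i \<in> {1..n}" for i
    using that by (auto simp: toeplitz_ops_def)
  have "quasifree_equiv n v (carrier BH) \<omega> \<tau> \<longleftrightarrow>
    (hilbert_dim (defect_space n ?S), hilbert_dim (defect_space n ?T)) \<in> ordIso"
  proof
    assume "quasifree_equiv n v (carrier BH) \<omega> \<tau>"
    then obtain W U where W: "unitary_op W" and U: "unitary_Dn n (carrier BH) U"
      and sigma: "\<And>x. x \<in> Dn n (carrier BH) \<Longrightarrow> sigma_rep n v \<omega> x = sigma_rep n v (Ad W \<circ> \<tau>) (U x)"
      unfolding quasifree_equiv_def free_equiv_def fixing_unitary_def by blast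
    have U1: "U \<in> Dn n (carrier BH) \<rightarrow> Dn n (carrier BH)"
      using U by (simp add: unitary_Dn_def L_Dn_def)
    obtain V where V: "V \<in> Dn n (carrier BH) \<rightarrow> Dn n (carrier BH)"
      "\<And>x. x \<in> Dn n (carrier BH) \<Longrightarrow> U (V x) = x"
      using U unfolding unitary_Dn_def L_Dn_def by blast
    \<comment> \<open>U and its inverse V each give one inclusion, so the defect spaces of \<omega>
      and of the conjugated \<tau> coincide.\<close>
    have "defect_space n (\<lambda>i. (Ad W \<circ> \<tau>) (v i)) \<subseteq> defect_space n ?S"
      by (rule free_equiv_defect_space_subset[OF bS U1 sigma])
    moreover have "defect_space n ?S \<subseteq> defect_space n (\<lambda>i. (Ad W \<circ> \<tau>) (v i))"
    proof (rule free_equiv_defect_space_subset[OF _ V(1)])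
      show "bounded_clinear ((Ad W \<circ> \<tau>) (v i))" if "i \<in> {1..n}" for i
        using bounded_clinear_Ad[OF W bT[OF that]] by simp
      show "sigma_rep n v (Ad W \<circ> \<tau>) x = sigma_rep n v \<omega> (V x)"
        if "x \<in> Dn n (carrier BH)" for x
        using sigma[of "V x"] V that by (simp add: Pi_iff)
    qed
    ultimately have "defect_space n ?S = defect_space n (\<lambda>i. Ad W (?T i))"
      by simp
    then show "(hilbert_dim (defect_space n ?S), hilbert_dim (defect_space n ?T)) \<in> ordIso"
      using hilbert_dim_defect_space_conj[OF W, of n ?T] bT by simp
  next
    assume "(hilbert_dim (defect_space n ?S), hilbert_dim (defect_space n ?T)) \<in> ordIso"
    then obtain W where W: "unitary_op W" and WT: "\<And>i h. i \<in> {1..n} \<Longrightarrow> W (?T i h) = ?S i h"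
      using intertwining_unitary[OF S T] by blast
    let ?U = "\<lambda>x :: nat \<Rightarrow> 'h \<Rightarrow> 'h. \<lambda>i\<in>{1..n}. W \<circ> x i"
    have U: "unitary_Dn n (carrier BH) ?U"
      by (rule unitary_Dn_diagonal[OF W])
    have "sigma_rep n v \<omega> x = sigma_rep n v (Ad W \<circ> \<tau>) (?U x)"
      if x: "x \<in> Dn n (carrier BH)" for x
    proof
      fix h
      have "?U x \<in> Dn n (carrier BH)"
        using U x unfolding unitary_Dn_def L_Dn_def by blast
      then show "sigma_rep n v \<omega> x h = sigma_rep n v (Ad W \<circ> \<tau>) (?U x) h"
        \<comment> \<open>The inner \<open>adj W\<close> cancels against the W of the diagonal,
          leaving W \<tau>(v_i) = \<omega>(v_i) in each summand.\<close>
        by (simp add: sigma_rep_apply x Ad_apply unitary_opD[OF W] WT)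
    qed
    then show "quasifree_equiv n v (carrier BH) \<omega> \<tau>"
      unfolding quasifree_equiv_def free_equiv_def using fixing_unitary_BH[OF W] U by blast
  qed
  then show ?thesis
    using rep_multiplicity_eq_hilbert_dim assms by metis
qed

end
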